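(* For any $0<\varepsilon<1$ there is a constant $c'_\varepsilon>0$ (depending only on $\varepsilon$) for which the following holds. Let $G$ be any group and let $\pi: G\to B(H)$ be any unitary representation of $G$ on a finite dimensional Hilbert space $H$. Assume that there is an $n$-element subset $S\subset G$ such that $\varepsilon(\pi\otimes\overline{\pi},S)\ge \varepsilon$, or equivalently such that $$\lambda(\pi\otimes\overline{\pi},S)\le 1-\varepsilon .$$ Let $\pi=\bigoplus_{t\in T}\pi_t$ be the decomposition of $\pi$ into distinct (i.e. pairwise not unitarily equivalent) irreducible unitary representations, where each $\pi_t$ appears with multiplicity $d_t\ge 1$. Then for every integer $N\ge 1$, $$|\{t\in T\mid \dim(\pi_t)\le N\}|\le \exp\left(c'_\varepsilon\, n N^2\right).$$
   Context: For a group $G$, a finite subset $S\subset G$ with $|S|=n$, and a unitary representation $\rho$ of $G$ on a Hilbert space $H_\rho$, let $H_\rho^{\mathrm{inv}}\subset H_\rho$ denote the subspace of all $\rho$-invariant vectors (vectors fixed by $\rho(g)$ for all $g\in G$), and define $$\lambda(\rho,S)=n^{-1}\sup\Big\{\Re\Big\langle \sum_{s\in S}\rho(s)\xi,\xi\Big\rangle \;\Big|\; \xi\in (H_\rho^{\mathrm{inv}})^\perp,\ \|\xi\|_{H_\rho}=1\Big\},\qquad \varepsilon(\rho,S)=1-\lambda(\rho,S).$$ If $(H_\rho^{\mathrm{inv}})^\perp=\{0\}$ the supremum over the empty set is taken to be $-\infty$ (so the condition $\lambda(\rho,S)\le 1-\varepsilon$ holds vacuously). Here $\overline{\pi}$ denotes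 the complex conjugate representation of $\pi$, acting on the conjugate Hilbert space $\overline{H}$, and $\pi\otimes\overline{\pi}$ is the representation $g\mapsto \pi(g)\otimes\overline{\pi(g)}$ on $H\otimes\overline{H}$. *)

theory Defs
  imports
    Jordan_Normal_Form.Schur_Decomposition
    Jordan_Normal_Form.VS_Connect
    "HOL-Library.Extended_Real"
begin

text \<open>
  An \<open>m\<close>-dimensional Hilbert space is taken, via an orthonormal basis, to be \<open>carrier_vec m\<close> over the
  complex numbers with inner product \<open>v \<bullet>c w\<close> (linear in \<open>v\<close>, conjugate linear in \<open>w\<close>). The
  dimension is a natural number and not a type, so that it can be quantified over after the
  constant in the theorem has been chosen.
\<close>

definition unitary_mat :: "nat \<Rightarrow> complex mat \<Rightarrow> bool" where
  "unitary_mat m U \<longleftrightarrow>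
     U \<in> carrier_mat m m \<and> mat_adjoint U * U = 1\<^sub>m m \<and> U * mat_adjoint U = 1\<^sub>m m"

definition unitary_group :: "nat \<Rightarrow> complex mat monoid" where
  "unitary_group m = \<lparr>carrier = {U. unitary_mat m U}, monoid.mult = (*), one = 1\<^sub>m m\<rparr>"

definition unitary_rep :: "'g monoid \<Rightarrow> nat \<Rightarrow> ('g \<Rightarrow> complex mat) \<Rightarrow> bool" where
  "unitary_rep G m \<rho> \<longleftrightarrow> \<rho> \<in> hom G (unitary_group m)"

definition inv_vecs :: "'g monoid \<Rightarrow> nat \<Rightarrow> ('g \<Rightarrow> complex mat) \<Rightarrow> complex vec set" where
  "inv_vecs G m \<rho> = {v \<in> carrier_vec m. \<forall>g\<in>carrier G. \<rho> g *\<^sub>v v = v}"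

definition orth_compl :: "nat \<Rightarrow> complex vec set \<Rightarrow> complex vec set" where
  "orth_compl m W = {\<xi> \<in> carrier_vec m. \<forall>v\<in>W. \<xi> \<bullet>c v = 0}"

text \<open>
  The supremum is taken in the extended reals, where the supremum of the empty set is \<open>-\<infinity>\<close>;
  the values are only meaningful for nonempty finite \<open>S\<close>.
\<close>

definition lambda_rep ::
  "'g monoid \<Rightarrow> nat \<Rightarrow> ('g \<Rightarrow> complex mat) \<Rightarrow> 'g set \<Rightarrow> ereal" where
  "lambda_rep G m \<rho> S = ereal (1 / real (card S)) *
     (SUP \<xi> \<in> {\<xi> \<in> orth_compl m (inv_vecs G m \<rho>). \<xi> \<bullet>c \<xi> = 1}.
        ereal (Re (finsum_vec TYPE(complex) m (\<lambda>s. \<rho> s *\<^sub>v \<xi>) S \<bullet>c \<xi>)))"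

definition epsilon_rep ::
  "'g monoid \<Rightarrow> nat \<Rightarrow> ('g \<Rightarrow> complex mat) \<Rightarrow> 'g set \<Rightarrow> ereal" where
  "epsilon_rep G m \<rho> S = 1 - lambda_rep G m \<rho> S"

text \<open>
  Kronecker product: the matrix of \<open>A \<otimes> B\<close> in the product basis, the basis vector
  \<open>e\<^sub>i \<otimes> e\<^sub>j\<close> having index \<open>i * k + j\<close> where \<open>k\<close> is the dimension of the second factor.
\<close>

definition kronecker :: "complex mat \<Rightarrow> complex mat \<Rightarrow> complex mat" where
  "kronecker A B = mat (dim_row A * dim_row B) (dim_col A * dim_col B)
     (\<lambda>(i, j). A $$ (i div dim_row B, j div dim_col B) * B $$ (i mod dim_row B, j mod dim_col B))"

text \<open>
  In the basis of the conjugate Hilbert space given by the standard basis, the operator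
  conjugate to a matrix \<open>A\<close> has the entrywise conjugate matrix (no transposition).
\<close>

definition conj_rep :: "('g \<Rightarrow> complex mat) \<Rightarrow> 'g \<Rightarrow> complex mat" where
  "conj_rep \<rho> g = map_mat cnj (\<rho> g)"

definition tensor_rep ::
  "('g \<Rightarrow> complex mat) \<Rightarrow> ('g \<Rightarrow> complex mat) \<Rightarrow> 'g \<Rightarrow> complex mat" where
  "tensor_rep \<rho> \<sigma> g = kronecker (\<rho> g) (\<sigma> g)"

definition irreducible_rep :: "'g monoid \<Rightarrow> nat \<Rightarrow> ('g \<Rightarrow> complex mat) \<Rightarrow> bool" where
  "irreducible_rep G m \<rho> \<longleftrightarrow> 0 < m \<and>
     (\<forall>W. VectorSpace.subspace class_ring W (module_vec TYPE(complex) m) \<longrightarrow>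
          (\<forall>g\<in>carrier G. \<forall>w\<in>W. \<rho> g *\<^sub>v w \<in> W) \<longrightarrow>
          W = {0\<^sub>v m} \<or> W = carrier_vec m)"

definition unitarily_equivalent ::
  "'g monoid \<Rightarrow> nat \<Rightarrow> ('g \<Rightarrow> complex mat) \<Rightarrow> nat \<Rightarrow> ('g \<Rightarrow> complex mat) \<Rightarrow> bool" where
  "unitarily_equivalent G m \<rho> k \<sigma> \<longleftrightarrow>
     m = k \<and> (\<exists>U. unitary_mat m U \<and> (\<forall>g\<in>carrier G. U * \<rho> g = \<sigma> g * U))"

text \<open>
  \<open>direct_sum T d \<sigma>\<close> is the orthogonal direct sum over the finite index set \<open>T\<close> of \<open>d t\<close>
  copies of \<open>\<sigma> t\<close>. The index type \<open>nat\<close> is no restriction, as the index sets are finite;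
  its order only serves to arrange the diagonal blocks.
\<close>

definition direct_sum ::
  "nat set \<Rightarrow> (nat \<Rightarrow> nat) \<Rightarrow> (nat \<Rightarrow> 'g \<Rightarrow> complex mat) \<Rightarrow> 'g \<Rightarrow> complex mat" where
  "direct_sum T d \<sigma> g =
     diag_block_mat (concat (map (\<lambda>t. replicate (d t) (\<sigma> t g)) (sorted_list_of_set T)))"

text \<open>
  \<open>\<sigma> t\<close>, of dimension \<open>k t\<close>, are the distinct irreducible components of \<open>\<pi>\<close>
  and \<open>d t\<close> their multiplicities.
\<close>

definition irreducible_decomposition ::
  "'g monoid \<Rightarrow> nat \<Rightarrow> ('g \<Rightarrow> complex mat) \<Rightarrow>
   nat set \<Rightarrow> (nat \<Rightarrow> nat) \<Rightarrow> (nat \<Rightarrow> 'g \<Rightarrow> complex mat) \<Rightarrow> (nat \<Rightarrow> nat) \<Rightarrow> bool" where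
  "irreducible_decomposition G m \<pi> T k \<sigma> d \<longleftrightarrow>
     finite T \<and>
     (\<forall>t\<in>T. unitary_rep G (k t) (\<sigma> t) \<and> irreducible_rep G (k t) (\<sigma> t) \<and> 1 \<le> d t) \<and>
     (\<forall>s\<in>T. \<forall>t\<in>T. s \<noteq> t \<longrightarrow> \<not> unitarily_equivalent G (k s) (\<sigma> s) (k t) (\<sigma> t)) \<and>
     unitarily_equivalent G m \<pi> (\<Sum>t\<in>T. d t * k t) (direct_sum T d \<sigma>)"

text \<open>
  \<open>bound_holds TYPE('g) \<epsilon> c\<close>: the bound with \<open>c\<close> in the role of \<open>c'\<^sub>\<epsilon>\<close> holds for all groups
  with elements of type \<open>'g\<close>. As HOL cannot quantify over types inside a formula, the mere
  existence of \<open>c > 0\<close> with \<open>bound_holds TYPE('g) \<epsilon> c\<close> would allow \<open>c\<close> to depend on \<open>'g\<close>. The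
  theorem excludes this by taking \<open>c\<close> from the fixed type \<open>nat\<close> and asserting that every such
  \<open>c\<close> works for arbitrary \<open>'g\<close>.
\<close>

definition bound_holds :: "'g itself \<Rightarrow> real \<Rightarrow> real \<Rightarrow> bool" where
  "bound_holds TYPE('g) \<epsilon> c \<longleftrightarrow>
     (\<forall>(G :: 'g monoid) m \<pi> S T k \<sigma> d N.
        group G \<longrightarrow> unitary_rep G m \<pi> \<longrightarrow>
        S \<subseteq> carrier G \<longrightarrow> finite S \<longrightarrow> S \<noteq> {} \<longrightarrow>
        ereal \<epsilon> \<le> epsilon_rep G (m * m) (tensor_rep \<pi> (conj_rep \<pi>)) S \<longrightarrow>
        irreducible_decomposition G m \<pi> T k \<sigma> d \<longrightarrow>
        1 \<le> N \<longrightarrow>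
        real (card {t \<in> T. k t \<le> N}) \<le> exp (c * real (card S) * (real N)\<^sup>2))"

end

theory Submission
  imports Defs "Jordan_Normal_Form.Spectral_Radius" "HOL-Algebra.Generated_Groups"
    "HOL-Library.Function_Algebras"
begin

text \<open>
  Identify \<open>\<pi> \<otimes> cnj \<pi>\<close> with the conjugation action of \<open>G\<close> on operators. For inequivalent components
  \<open>\<sigma>\<close>, \<open>\<tau>\<close> of the same dimension \<open>l\<close>, with coisometric intertwiners \<open>V\<close>, \<open>W\<close> from \<open>\<pi>\<close>, the operator
  \<open>V\<^sup>* W\<close> is orthogonal to the invariant ones by Schur's lemma, so that the spectral gap gives
  \<open>Re (\<Sum>s\<in>S. tr (\<sigma> s \<tau>(s)\<^sup>*)) \<le> (1 - \<epsilon>) n l\<close>. Hence the points \<open>(\<sigma> s)\<close>, \<open>s \<in> S\<close>, lie on a sphere of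
  radius \<open>sqrt (n l)\<close> in a real space of dimension \<open>2 n l\<^sup>2\<close> and are separated by \<open>sqrt (2 \<epsilon>)\<close> times the
  radius, and there are at most \<open>exp (O(n l\<^sup>2))\<close> of them. Summing over \<open>l \<le> N\<close> costs a factor \<open>N\<close>.

  To pass from groups on \<open>nat\<close> to arbitrary ones, replace \<open>G\<close> by a countable subgroup that contains
  \<open>S\<close> and finitely many elements whose images span the images of all of \<open>G\<close>.
\<close>

section \<open>Separated points on a sphere\<close>

text \<open>Stars and bars: with one extra slack entry the families become lists of length
  \<open>card I + 1\<close> with sum exactly \<open>M\<close>, of which there are
  \<open>(M + card I) choose M\<close>.\<close>

lemma card_le_bounded_sum_family:
  fixes z :: "'a \<Rightarrow> 'i \<Rightarrow> nat"
  assumes "finite I"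
    and inj: "\<And>s t. s \<in> A \<Longrightarrow> t \<in> A \<Longrightarrow> (\<And>i. i \<in> I \<Longrightarrow> z s i = z t i) \<Longrightarrow> s = t"
    and le: "\<And>t. t \<in> A \<Longrightarrow> sum (z t) I \<le> M"
  shows "card A \<le> 2 ^ (M + card I)"
proof -
  obtain xs where xs: "set xs = I" "distinct xs"
    using finite_distinct_list[OF \<open>finite I\<close>] by blast
  have len: "length xs = card I" using xs by (metis distinct_card)
  define L where "L = {l::nat list. length l = Suc (card I) \<and> sum_list l = M}"
  \<comment> \<open>The head is the slack; by the hypothesis \<open>le\<close> the truncated
    subtraction is exact on \<open>A\<close>.\<close>
  define f where "f t = (M - sum (z t) I) # map (z t) xs" for t
  have card_L: "card L = (M + card I) choose M"
    unfolding L_def by (subst card_length_sum_list) simp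
  then have "card L > 0" by simp
  then have "finite L" by (rule card_ge_0_finite)
  have "f ` A \<subseteq> L"
  proof
    fix l assume "l \<in> f ` A"
    then obtain t where t: "t \<in> A" "l = f t" by blast
    have "sum_list (map (z t) xs) = sum (z t) I"
      using xs by (simp add: sum_list_distinct_conv_sum_set)
    then show "l \<in> L" using t le[OF t(1)] len by (simp add: L_def f_def)
  qed
  moreover have "inj_on f A"
  proof (rule inj_onI)
    fix s t assume st: "s \<in> A" "t \<in> A" "f s = f t"
    then have "map (z s) xs = map (z t) xs" by (simp add: f_def)
    then show "s = t" using inj[OF st(1,2)] xs(1) by (simp add: map_eq_conv)
  qed
  ultimately have "card A \<le> card L" using \<open>finite L\<close> card_inj_on_le by blast
  also have "\<dots> \<le> 2 ^ (M + card I)" unfolding card_L by (rule binomial_le_pow2)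
  finally show ?thesis .
qed

text \<open>\<open>nat\<close> cuts negative values off to 0, so at most one summand survives, and a
  natural number is at most its own square. This is how a Euclidean bound controls the total number
  of unit steps after rounding.\<close>

lemma nat_floor_add_nat_floor_minus_le_square:
  fixes y :: real
  shows "real (nat \<lfloor>y\<rfloor> + nat \<lfloor>- y\<rfloor>) \<le> y\<^sup>2"
proof -
  have *: "real (nat \<lfloor>w\<rfloor> + nat \<lfloor>- w\<rfloor>) \<le> w\<^sup>2" if "0 \<le> w" for w :: real
  proof -
    have "real (nat \<lfloor>w\<rfloor>) \<le> (real (nat \<lfloor>w\<rfloor>))\<^sup>2"
      using le_square[of "nat \<lfloor>w\<rfloor>"] by (simp add: power2_eq_square flip: of_nat_mult)
    also have "\<dots> \<le> w\<^sup>2" using that by (intro power_mono) auto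
    finally show ?thesis using that by simp
  qed
  show ?thesis
  proof (cases "0 \<le> y")
    case False
    with *[of "- y"] show ?thesis by (simp add: add.commute)
  qed (rule *)
qed

text \<open>The cells of this rounding are intervals of length 1, except for the cell at the origin,
  which is the open interval from -1 to 1 and accounts for the constant 2.\<close>

lemma abs_diff_less_if_nat_floor_eq:
  fixes y w :: real
  assumes "nat \<lfloor>y\<rfloor> = nat \<lfloor>w\<rfloor>" "nat \<lfloor>- y\<rfloor> = nat \<lfloor>- w\<rfloor>"
  shows "\<bar>y - w\<bar> < 2"
  using assms by linarith

text \<open>Rounding the coordinates at scale \<open>h\<close> separates the points, and leaves at most \<open>R / h\<^sup>2\<close>
  unit steps to be distributed over \<open>2 * card I\<close> coordinates. In contrast to a volume comparison
  this does not need Lebesgue measure in a dimension that varies.\<close>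

lemma card_separated_le_exp:
  fixes x :: "'a \<Rightarrow> 'i \<Rightarrow> real"
  assumes "finite I" "I \<noteq> {}" "0 < R" "0 < \<epsilon>"
    and bound: "\<And>t. t \<in> A \<Longrightarrow> (\<Sum>i\<in>I. (x t i)\<^sup>2) \<le> R"
    and sep: "\<And>s t. s \<in> A \<Longrightarrow> t \<in> A \<Longrightarrow> s \<noteq> t \<Longrightarrow> 2 * \<epsilon> * R \<le> (\<Sum>i\<in>I. (x s i - x t i)\<^sup>2)"
  shows "real (card A) \<le> exp ((4 / \<epsilon> + 2) * real (card I))"
proof -
  define D where "D = real (card I)"
  have D: "0 < D" using assms(1,2) by (simp add: D_def card_gt_0_iff)
  \<comment> \<open>Two points in the same cell differ by less than \<open>2 * h\<close> in each of
    \<open>D\<close> coordinates. The scale is chosen so that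
    \<open>D * (2 * h)\<^sup>2 = \<epsilon> * R\<close>, half of the squared separation.\<close>
  define h where "h = sqrt (\<epsilon> * R / (4 * D))"
  have h2: "h\<^sup>2 = \<epsilon> * R / (4 * D)" and h: "0 < h"
    using D assms(3,4) by (auto simp: h_def)
  \<comment> \<open>The flag \<open>b\<close> stores the positive and the negative part of a rounded
    coordinate as two natural numbers.\<close>
  define z where "z t = (\<lambda>(i, b). nat \<lfloor>if b then x t i / h else - (x t i / h)\<rfloor>)" for t
  \<comment> \<open>This is \<open>R / h\<^sup>2\<close> rounded down, the number of available unit
    steps.\<close>
  define M where "M = nat \<lfloor>4 * D / \<epsilon>\<rfloor>"
  have "card A \<le> 2 ^ (M + card (I \<times> (UNIV :: bool set)))"
  proof (rule card_le_bounded_sum_family)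
    show "finite (I \<times> (UNIV :: bool set))" using assms(1) by simp
  next
    fix t assume t: "t \<in> A"
    have "sum (z t) (I \<times> UNIV) = (\<Sum>i\<in>I. nat \<lfloor>x t i / h\<rfloor> + nat \<lfloor>- (x t i / h)\<rfloor>)"
      by (simp add: z_def UNIV_bool add.commute flip: sum.cartesian_product)
    then have "real (sum (z t) (I \<times> UNIV)) \<le> (\<Sum>i\<in>I. (x t i / h)\<^sup>2)"
      by (simp only: of_nat_sum) (intro sum_mono nat_floor_add_nat_floor_minus_le_square)
    also have "\<dots> = (\<Sum>i\<in>I. (x t i)\<^sup>2) / h\<^sup>2" by (simp add: power_divide sum_divide_distrib)
    also have "\<dots> \<le> R / h\<^sup>2" using bound[OF t] by (intro divide_right_mono) auto
    also have "\<dots> = 4 * D / \<epsilon>" using D assms(3,4) by (simp add: h2 field_simps)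
    finally show "sum (z t) (I \<times> UNIV) \<le> M" unfolding M_def by linarith
  next
    fix s t assume st: "s \<in> A" "t \<in> A" and eq: "\<And>j. j \<in> I \<times> UNIV \<Longrightarrow> z s j = z t j"
    show "s = t"
    proof (rule ccontr)
      assume "s \<noteq> t"
      have "(x s i - x t i)\<^sup>2 \<le> 4 * h\<^sup>2" if "i \<in> I" for i
      proof -
        have "\<bar>x s i / h - x t i / h\<bar> < 2"
          using eq[of "(i, True)"] eq[of "(i, False)"] that
          by (intro abs_diff_less_if_nat_floor_eq) (auto simp: z_def)
        then have "\<bar>x s i - x t i\<bar> < 2 * h"
          using h by (simp add: field_simps flip: diff_divide_distrib)
        then have "\<bar>x s i - x t i\<bar>\<^sup>2 \<le> (2 * h)\<^sup>2" by (intro power_mono) auto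
        then show ?thesis by (simp add: power_mult_distrib)
      qed
      then have "(\<Sum>i\<in>I. (x s i - x t i)\<^sup>2) \<le> D * (4 * h\<^sup>2)"
        unfolding D_def by (rule sum_bounded_above)
      also have "\<dots> = \<epsilon> * R" using D by (simp add: h2)
      also have "\<dots> < 2 * \<epsilon> * R" using assms(3,4) by simp
      finally show False using sep[OF st \<open>s \<noteq> t\<close>] by simp
    qed
  qed
  then have "real (card A) \<le> real (2 ^ (M + 2 * card I))"
    by (simp only: of_nat_le_iff) (simp add: card_cartesian_product mult.commute)
  also have "\<dots> = 2 ^ (M + 2 * card I)" by simp
  also have "\<dots> \<le> exp 1 ^ (M + 2 * card I)"
    using exp_ge_add_one_self[of 1] by (intro power_mono) auto
  also have "\<dots> = exp (real (M + 2 * card I))" by (simp flip: exp_of_nat_mult)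
  also have "\<dots> \<le> exp ((4 / \<epsilon> + 2) * D)"
  proof -
    have "real M \<le> 4 * D / \<epsilon>" using D assms(4) by (simp add: M_def)
    then show ?thesis by (simp add: D_def field_simps)
  qed
  finally show ?thesis by (simp add: D_def)
qed

section \<open>Adjoints, traces and Schur's lemma\<close>

lemma dim_mat_adjoint [simp]:
  "dim_row (mat_adjoint A) = dim_col A" "dim_col (mat_adjoint A) = dim_row A"
  by (simp_all add: mat_adjoint_def)

lemma mat_adjoint_carrier [simp]:
  "A \<in> carrier_mat n m \<Longrightarrow> mat_adjoint A \<in> carrier_mat m n"
  by (metis carrier_matD carrier_matI dim_mat_adjoint)

lemma index_mat_adjoint [simp]:
  fixes A :: "complex mat"
  shows "i < dim_col A \<Longrightarrow> j < dim_row A \<Longrightarrow> mat_adjoint A $$ (i, j) = cnj (A $$ (j, i))"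
  by (simp add: mat_adjoint_def mat_of_rows_def)

lemma mat_adjoint_mat_adjoint [simp]:
  fixes A :: "complex mat"
  shows "mat_adjoint (mat_adjoint A) = A"
  by (rule eq_matI) simp_all

lemma mat_adjoint_mult:
  fixes A B :: "complex mat"
  assumes "A \<in> carrier_mat n m" "B \<in> carrier_mat m k"
  shows "mat_adjoint (A * B) = mat_adjoint B * mat_adjoint A"
  using assms by (intro eq_matI) (auto simp: scalar_prod_def mult.commute)

lemma mat_adjoint_smult:
  fixes A :: "complex mat"
  shows "mat_adjoint (c \<cdot>\<^sub>m A) = cnj c \<cdot>\<^sub>m mat_adjoint A"
  by (intro eq_matI) auto

definition mat_trace :: "complex mat \<Rightarrow> complex" where
  "mat_trace A = (\<Sum>i<dim_row A. A $$ (i, i))"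

lemma mat_trace_comm:
  assumes "A \<in> carrier_mat n m" "B \<in> carrier_mat m n"
  shows "mat_trace (A * B) = mat_trace (B * A)"
proof -
  have "mat_trace (A * B) = (\<Sum>i<n. \<Sum>j<m. A $$ (i, j) * B $$ (j, i))"
    using assms by (simp add: mat_trace_def scalar_prod_def lessThan_atLeast0)
  also have "\<dots> = (\<Sum>j<m. \<Sum>i<n. B $$ (j, i) * A $$ (i, j))"
    by (subst sum.swap) (simp add: mult.commute)
  also have "\<dots> = mat_trace (B * A)"
    using assms by (simp add: mat_trace_def scalar_prod_def lessThan_atLeast0)
  finally show ?thesis .
qed

lemma mat_trace_one: "mat_trace (1\<^sub>m k) = of_nat k"
  by (simp add: mat_trace_def)

lemma mat_trace_zero: "mat_trace (0\<^sub>m k k) = 0"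
  by (simp add: mat_trace_def)

lemma mat_trace_mult_adjoint:
  assumes "A \<in> carrier_mat n m" "B \<in> carrier_mat n m"
  shows "mat_trace (A * mat_adjoint B) = (\<Sum>i<n. \<Sum>j<m. A $$ (i, j) * cnj (B $$ (i, j)))"
  using assms by (simp add: mat_trace_def scalar_prod_def lessThan_atLeast0)

section \<open>Intertwiners and Schur's lemma\<close>

lemma unitary_repD:
  assumes "unitary_rep G m \<rho>" "g \<in> carrier G"
  shows "\<rho> g \<in> carrier_mat m m" "mat_adjoint (\<rho> g) * \<rho> g = 1\<^sub>m m"
    "\<rho> g * mat_adjoint (\<rho> g) = 1\<^sub>m m" "unitary_mat m (\<rho> g)"
  using assms by (auto simp: unitary_rep_def unitary_group_def unitary_mat_def hom_def)

text \<open>Take adjoints in \<open>V * A = B * V\<close>, then multiply by \<open>A\<close> on the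
  left and by \<open>B\<close> on the right.\<close>

lemma intertwiner_adjoint:
  assumes A: "unitary_mat m A" and B: "unitary_mat k B"
    and V: "V \<in> carrier_mat k m" and eq: "V * A = B * V"
  shows "A * mat_adjoint V = mat_adjoint V * B"
proof -
  have cA: "A \<in> carrier_mat m m" "A * mat_adjoint A = 1\<^sub>m m"
    and cB: "B \<in> carrier_mat k k" "mat_adjoint B * B = 1\<^sub>m k"
    using A B by (auto simp: unitary_mat_def)
  note c = cA(1) cB(1) V mat_adjoint_carrier[OF cA(1)] mat_adjoint_carrier[OF cB(1)]
    mat_adjoint_carrier[OF V]
  have "mat_adjoint A * mat_adjoint V = mat_adjoint V * mat_adjoint B"
    using eq mat_adjoint_mult[OF V cA(1)] mat_adjoint_mult[OF cB(1) V] by simp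
  then have eq': "A * (mat_adjoint A * mat_adjoint V) = A * (mat_adjoint V * mat_adjoint B)"
    by simp
  have "mat_adjoint V = A * (mat_adjoint A * mat_adjoint V)"
    using assoc_mult_mat[OF c(1,4,6)] unfolding cA(2) left_mult_one_mat[OF c(6)] .
  then have "mat_adjoint V * B = A * (mat_adjoint V * mat_adjoint B) * B"
    unfolding eq' by simp
  also have "\<dots> = A * (mat_adjoint V * (mat_adjoint B * B))"
    using assoc_mult_mat[OF c(1) mult_carrier_mat[OF c(6,5)] c(2)] assoc_mult_mat[OF c(6,5,2)] by simp
  finally show ?thesis using c cB(2) by simp
qed

lemma subspace_eigenspace:
  assumes P: "P \<in> carrier_mat k k"
  shows "VectorSpace.subspace class_ring {w \<in> carrier_vec k. P *\<^sub>v w = \<mu> \<cdot>\<^sub>v w}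
           (module_vec TYPE(complex) k)"
  unfolding VectorSpace.subspace_def submodule_def
  using P vec_vs[of k] vec_module[of k]
  by (auto simp: module_vec_simps class_ring_simps mult_add_distrib_mat_vec[OF P] mult_mat_vec[OF P]
      smult_add_distrib_vec smult_smult_assoc mult.commute)

text \<open>Schur's lemma over the complex numbers: \<open>P\<close> has an eigenvalue because
  \<open>k > 0\<close>, its eigenspace is invariant under \<tau> and nonzero, and so it is the whole
  space.\<close>

lemma commutes_irreducible_imp_scalar:
  assumes irr: "irreducible_rep G k \<tau>" and carr: "\<And>g. g \<in> carrier G \<Longrightarrow> \<tau> g \<in> carrier_mat k k"
    and P: "P \<in> carrier_mat k k" and comm: "\<And>g. g \<in> carrier G \<Longrightarrow> P * \<tau> g = \<tau> g * P"
  shows "\<exists>\<mu>. P = \<mu> \<cdot>\<^sub>m 1\<^sub>m k"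
proof -
  have "k > 0" using irr by (simp add: irreducible_rep_def)
  then obtain \<mu> v where v: "v \<in> carrier_vec k" "v \<noteq> 0\<^sub>v k" "P *\<^sub>v v = \<mu> \<cdot>\<^sub>v v"
    using spectrum_non_empty[OF P] P
    by (auto simp: spectrum_def eigenvalue_def eigenvector_def)
  define W where "W = {w \<in> carrier_vec k. P *\<^sub>v w = \<mu> \<cdot>\<^sub>v w}"
  have "\<forall>g\<in>carrier G. \<forall>w\<in>W. \<tau> g *\<^sub>v w \<in> W"
  proof (intro ballI)
    fix g w assume g: "g \<in> carrier G" and w: "w \<in> W"
    then have w': "w \<in> carrier_vec k" "P *\<^sub>v w = \<mu> \<cdot>\<^sub>v w" by (auto simp: W_def)
    have "P *\<^sub>v (\<tau> g *\<^sub>v w) = \<tau> g *\<^sub>v (P *\<^sub>v w)"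
      using w'(1) assoc_mult_mat_vec[OF P carr[OF g]] assoc_mult_mat_vec[OF carr[OF g] P] comm[OF g]
      by simp
    also have "\<dots> = \<mu> \<cdot>\<^sub>v (\<tau> g *\<^sub>v w)" using w' mult_mat_vec[OF carr[OF g]] by simp
    finally show "\<tau> g *\<^sub>v w \<in> W" using w' carr[OF g] by (simp add: W_def)
  qed
  moreover have "VectorSpace.subspace class_ring W (module_vec TYPE(complex) k)"
    unfolding W_def by (rule subspace_eigenspace[OF P])
  moreover have "v \<in> W" using v by (simp add: W_def)
  ultimately have W: "W = carrier_vec k" using irr v(2) unfolding irreducible_rep_def by blast
  have "P = \<mu> \<cdot>\<^sub>m 1\<^sub>m k"
  \<comment> \<open>Every vector is now an eigenvector; the unit vectors read off the columns of
    \<open>P\<close>.\<close>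
  proof (rule eq_matI)
    fix i j assume ij: "i < dim_row (\<mu> \<cdot>\<^sub>m 1\<^sub>m k)" "j < dim_col (\<mu> \<cdot>\<^sub>m 1\<^sub>m k)"
    then have "unit_vec k j \<in> W" by (simp add: W)
    then have "P *\<^sub>v unit_vec k j = \<mu> \<cdot>\<^sub>v unit_vec k j" by (simp add: W_def)
    then have "(P *\<^sub>v unit_vec k j) $ i = (\<mu> \<cdot>\<^sub>v unit_vec k j) $ i" by simp
    then show "P $$ (i, j) = (\<mu> \<cdot>\<^sub>m 1\<^sub>m k) $$ (i, j)" using ij P by auto
  qed (use P in auto)
  then show ?thesis by blast
qed

text \<open>\<open>mat_adjoint Z * Z\<close> commutes with \<tau> and is therefore a scalar. If
  \<open>Z\<close> were nonzero, this scalar would be positive, and \<open>Z\<close> divided by its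
  square root would be a unitary equivalence.\<close>

lemma schur_intertwiner_eq_zero:
  assumes \<sigma>: "unitary_rep G k \<sigma>" and \<tau>: "unitary_rep G k \<tau>" and irr: "irreducible_rep G k \<tau>"
    and Z: "Z \<in> carrier_mat k k" and eq: "\<And>g. g \<in> carrier G \<Longrightarrow> Z * \<tau> g = \<sigma> g * Z"
    and neq: "\<not> unitarily_equivalent G k \<tau> k \<sigma>"
  shows "Z = 0\<^sub>m k k"
proof -
  note Z' = mat_adjoint_carrier[OF Z]
  have P: "mat_adjoint Z * Z \<in> carrier_mat k k" by (rule mult_carrier_mat[OF Z' Z])
  have comm: "mat_adjoint Z * Z * \<tau> g = \<tau> g * (mat_adjoint Z * Z)" if g: "g \<in> carrier G" for g
  proof -
    note c = unitary_repD(1)[OF \<sigma> g] unitary_repD(1)[OF \<tau> g]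
    have "mat_adjoint Z * Z * \<tau> g = mat_adjoint Z * (\<sigma> g * Z)"
      using assoc_mult_mat[OF Z' Z c(2)] eq[OF g] by simp
    also have "\<dots> = (mat_adjoint Z * \<sigma> g) * Z" using assoc_mult_mat[OF Z' c(1) Z] by simp
    also have "mat_adjoint Z * \<sigma> g = \<tau> g * mat_adjoint Z"
      using intertwiner_adjoint[OF unitary_repD(4)[OF \<tau> g] unitary_repD(4)[OF \<sigma> g] Z eq[OF g]] ..
    finally show ?thesis using assoc_mult_mat[OF c(2) Z' Z] by simp
  qed
  obtain \<mu> where \<mu>: "mat_adjoint Z * Z = \<mu> \<cdot>\<^sub>m 1\<^sub>m k"
    using commutes_irreducible_imp_scalar[OF irr unitary_repD(1)[OF \<tau>] P comm] by blast
  \<comment> \<open>A diagonal entry of \<open>mat_adjoint Z * Z\<close> is the squared length of a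
    column of \<open>Z\<close>, so \<mu> is real and nonnegative, and positive once some entry of
    \<open>Z\<close> is nonzero.\<close>
  have diag: "\<mu> = of_real (\<Sum>i<k. (cmod (Z $$ (i, j)))\<^sup>2)" if "j < k" for j
  proof -
    have "\<mu> = (mat_adjoint Z * Z) $$ (j, j)" using that by (simp add: \<mu>)
    also have "\<dots> = (\<Sum>i<k. cnj (Z $$ (i, j)) * Z $$ (i, j))"
      using that Z by (simp add: scalar_prod_def lessThan_atLeast0)
    finally show ?thesis by (simp only: of_real_sum complex_norm_square mult.commute)
  qed
  show ?thesis
  proof (rule ccontr)
    assume "Z \<noteq> 0\<^sub>m k k"
    then obtain i j where ij: "i < k" "j < k" "Z $$ (i, j) \<noteq> 0"
      using Z by (metis carrier_matD eq_matI index_zero_mat)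
    define r where "r = (\<Sum>i<k. (cmod (Z $$ (i, j)))\<^sup>2)"
    have "r > 0" unfolding r_def using ij by (intro sum_pos2[of _ i]) auto
    have \<mu>r: "\<mu> = of_real r" using diag[OF ij(2)] by (simp add: r_def)
    define c where "c = complex_of_real (1 / sqrt r)"
    have cc: "cnj c * (c * \<mu>) = 1"
      using \<open>r > 0\<close> by (simp add: c_def \<mu>r field_simps flip: of_real_mult)
    define U where "U = c \<cdot>\<^sub>m Z"
    have U: "U \<in> carrier_mat k k" using Z by (simp add: U_def)
    have "mat_adjoint U * U = cnj c \<cdot>\<^sub>m (c \<cdot>\<^sub>m (mat_adjoint Z * Z))"
      unfolding U_def mat_adjoint_smult
        mult_smult_assoc_mat[OF Z' smult_carrier_mat[OF Z]] mult_smult_distrib[OF Z' Z] ..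
    also have "\<dots> = 1\<^sub>m k" unfolding \<mu> using cc by (intro eq_matI) auto
    finally have UU: "mat_adjoint U * U = 1\<^sub>m k" .
    then have "unitary_mat k U"
      \<comment> \<open>A one-sided inverse of a square matrix is two-sided.\<close>
      using mat_mult_left_right_inverse[OF mat_adjoint_carrier[OF U] U] U
      by (simp add: unitary_mat_def)
    moreover have "U * \<tau> g = \<sigma> g * U" if g: "g \<in> carrier G" for g
      unfolding U_def mult_smult_assoc_mat[OF Z unitary_repD(1)[OF \<tau> g]]
        mult_smult_distrib[OF unitary_repD(1)[OF \<sigma> g] Z] eq[OF g] ..
    ultimately show False using neq by (auto simp: unitarily_equivalent_def)
  qed
qed

section \<open>The spectral gap\<close>

lemma mult_add_less_mult:
  fixes i j a b :: nat
  assumes "i < a" "j < b"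
  shows "i * b + j < a * b"
proof -
  have "i * b + j < Suc i * b" using assms(2) by simp
  also have "\<dots> \<le> a * b" using assms(1) by (intro mult_le_mono1) simp
  finally show ?thesis .
qed

text \<open>Splits the index of the product basis, with \<open>i * b + j\<close> standing for the
  pair \<open>(i, j)\<close> as in \<open>kronecker\<close>.\<close>

lemma sum_div_mod:
  fixes f :: "nat \<Rightarrow> nat \<Rightarrow> 'a :: comm_monoid_add"
  shows "(\<Sum>i<a * b. f (i div b) (i mod b)) = (\<Sum>i<a. \<Sum>j<b. f i j)"
proof -
  have *: "i div b < a \<and> i mod b < b" if "i < a * b" for i
    using that by (cases "b = 0") (auto simp: less_mult_imp_div_less)
  have **: "i * b + j < a * b" if "i < a" "j < b" for i j
    using mult_add_less_mult[OF that] .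
  show ?thesis
    unfolding sum.cartesian_product
    by (rule sum.reindex_bij_witness[where i = "\<lambda>(i, j). i * b + j" and j = "\<lambda>i. (i div b, i mod b)"])
       (use * ** in auto)
qed

text \<open>Identifies \<open>H \<otimes> cnj H\<close> with the Hilbert--Schmidt operators on \<open>H\<close>.\<close>

definition vec_of_mat :: "nat \<Rightarrow> complex mat \<Rightarrow> complex vec" where
  "vec_of_mat m X = vec (m * m) (\<lambda>i. X $$ (i div m, i mod m))"

lemma vec_of_mat_carrier [simp]: "vec_of_mat m X \<in> carrier_vec (m * m)"
  by (simp add: vec_of_mat_def)

lemma vec_of_mat_inner:
  assumes "X \<in> carrier_mat m m" "Y \<in> carrier_mat m m"
  shows "vec_of_mat m X \<bullet>c vec_of_mat m Y = mat_trace (X * mat_adjoint Y)"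
  unfolding mat_trace_mult_adjoint[OF assms] sum_div_mod[symmetric]
  by (simp add: vec_of_mat_def scalar_prod_def lessThan_atLeast0)

lemma ex_vec_of_mat:
  assumes "v \<in> carrier_vec (m * m)"
  obtains X where "X \<in> carrier_mat m m" "v = vec_of_mat m X"
proof
  let ?X = "mat m m (\<lambda>(i, j). v $ (i * m + j))"
  show "?X \<in> carrier_mat m m" by simp
  show "v = vec_of_mat m ?X"
  proof (rule eq_vecI)
    fix i assume "i < dim_vec (vec_of_mat m ?X)"
    then have i: "i < m * m" by (simp add: vec_of_mat_def)
    then have "i div m < m" "i mod m < m"
      by (cases "m = 0"; simp add: less_mult_imp_div_less)+
    then show "v $ i = vec_of_mat m ?X $ i" using i by (simp add: vec_of_mat_def)
  qed (use assms in \<open>simp add: vec_of_mat_def\<close>)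
qed

lemma vec_of_mat_inject:
  assumes "X \<in> carrier_mat m m" "Y \<in> carrier_mat m m" "vec_of_mat m X = vec_of_mat m Y"
  shows "X = Y"
proof (rule eq_matI)
  fix i j assume "i < dim_row Y" "j < dim_col Y"
  then have ij: "i < m" "j < m" using assms by auto
  have "i * m + j < m * m" using mult_add_less_mult[OF ij] .
  moreover have "vec_of_mat m X $ (i * m + j) = vec_of_mat m Y $ (i * m + j)"
    using assms(3) by simp
  ultimately show "X $$ (i, j) = Y $$ (i, j)" using ij by (simp add: vec_of_mat_def)
qed (use assms in auto)

text \<open>With \<open>A = B = \<pi> g\<close> the tensor representation acts on operators by
  conjugation, since \<pi> is unitary. Its invariant vectors are then the operators that commute
  with \<pi>.\<close>

lemma kronecker_mult_vec_of_mat: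
  assumes "A \<in> carrier_mat m m" "B \<in> carrier_mat m m" "X \<in> carrier_mat m m"
  shows "kronecker A (map_mat cnj B) *\<^sub>v vec_of_mat m X = vec_of_mat m (A * X * mat_adjoint B)"
proof (rule eq_vecI)
  fix i assume "i < dim_vec (vec_of_mat m (A * X * mat_adjoint B))"
  then have i: "i < m * m" by (simp add: vec_of_mat_def)
  then have ij: "i div m < m" "i mod m < m"
    by (cases "m = 0"; simp add: less_mult_imp_div_less)+
  have lt: "j div m < m" "j mod m < m" if "j < m * m" for j
    using that by (cases "m = 0"; simp add: less_mult_imp_div_less)+
  have "(kronecker A (map_mat cnj B) *\<^sub>v vec_of_mat m X) $ i =
     (\<Sum>j<m * m. A $$ (i div m, j div m) * cnj (B $$ (i mod m, j mod m)) * X $$ (j div m, j mod m))"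
    using assms i ij lt by (simp add: kronecker_def vec_of_mat_def scalar_prod_def lessThan_atLeast0)
  also have "\<dots> = (\<Sum>p<m. \<Sum>q<m. A $$ (i div m, p) * cnj (B $$ (i mod m, q)) * X $$ (p, q))"
    by (rule sum_div_mod)
  also have "\<dots> = (\<Sum>q<m. (\<Sum>p<m. A $$ (i div m, p) * X $$ (p, q)) * cnj (B $$ (i mod m, q)))"
    by (subst sum.swap, simp only: sum_distrib_right, simp only: ac_simps)
  also have "\<dots> = vec_of_mat m (A * X * mat_adjoint B) $ i"
    using assms i ij by (simp add: vec_of_mat_def scalar_prod_def lessThan_atLeast0)
  finally show "(kronecker A (map_mat cnj B) *\<^sub>v vec_of_mat m X) $ i =
    vec_of_mat m (A * X * mat_adjoint B) $ i" .
qed (use assms in \<open>simp add: vec_of_mat_def kronecker_def\<close>)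

lemma finsum_vec_inner:
  fixes f :: "'s \<Rightarrow> complex vec"
  assumes "finite S" "f \<in> S \<rightarrow> carrier_vec m" "\<xi> \<in> carrier_vec m"
  shows "finsum_vec TYPE(complex) m f S \<bullet>c \<xi> = (\<Sum>s\<in>S. f s \<bullet>c \<xi>)"
  using assms
proof (induction S rule: finite_induct)
  case empty
  then show ?case by (simp add: finsum_vec_empty)
next
  case (insert s S)
  then have f: "f \<in> S \<rightarrow> carrier_vec m" "f s \<in> carrier_vec m" by auto
  show ?case
    using insert f finsum_vec_closed[OF f(1)]
    by (simp add: finsum_vec_insert[OF insert(1,2) f] add_scalar_prod_distrib[of _ m])
qed

text \<open>Both sides are homogeneous of degree 2 in \<xi>, so the supremum over unit vectors
  becomes an inequality for all vectors of the orthogonal complement, with the zero vector treated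
  separately.\<close>

lemma epsilon_rep_le_imp:
  assumes S: "finite S" "S \<noteq> {}" and \<epsilon>: "ereal \<epsilon> \<le> epsilon_rep G m \<rho> S"
    and carr: "\<And>s. s \<in> S \<Longrightarrow> \<rho> s \<in> carrier_mat m m"
    and \<xi>: "\<xi> \<in> orth_compl m (inv_vecs G m \<rho>)"
  shows "Re (\<Sum>s\<in>S. (\<rho> s *\<^sub>v \<xi>) \<bullet>c \<xi>) \<le> (1 - \<epsilon>) * real (card S) * Re (\<xi> \<bullet>c \<xi>)"
proof -
  have \<xi>c: "\<xi> \<in> carrier_vec m" using \<xi> by (simp add: orth_compl_def)
  have inv: "v \<in> carrier_vec m" if "v \<in> inv_vecs G m \<rho>" for v
    using that by (simp add: inv_vecs_def)
  have n: "0 < real (card S)" using S by (simp add: card_gt_0_iff)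
  show ?thesis
  proof (cases "\<xi> = 0\<^sub>v m")
    case True
    have "(\<rho> s *\<^sub>v \<xi>) \<bullet>c \<xi> = 0" if "s \<in> S" for s
      using carr[OF that] \<xi>c by (simp add: True)
    then show ?thesis by (simp add: True)
  next
    case False
    \<comment> \<open>The order on the complex numbers compares real parts and demands equal
      imaginary parts, so this also says that the value is real.\<close>
    have "\<xi> \<bullet>c \<xi> > 0" using \<xi>c False by (simp add: conjugate_square_greater_0_vec)
    then obtain r where r: "\<xi> \<bullet>c \<xi> = of_real r" "r > 0"
      using that[of "Re (\<xi> \<bullet>c \<xi>)"] by (simp add: less_complex_def complex_eq_iff)
    define c where "c = complex_of_real (1 / sqrt r)"
    have cc: "c * cnj c = of_real (1 / r)"
      using r(2) by (simp add: c_def flip: of_real_mult)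
    define \<eta> where "\<eta> = c \<cdot>\<^sub>v \<xi>"
    have \<eta>c: "\<eta> \<in> carrier_vec m" using \<xi>c by (simp add: \<eta>_def)
    have scale: "(c \<cdot>\<^sub>v v) \<bullet>c \<eta> = of_real (1 / r) * (v \<bullet>c \<xi>)" if "v \<in> carrier_vec m" for v
      unfolding cc[symmetric] using that \<xi>c by (simp add: \<eta>_def conjugate_smult_vec ac_simps)
    have "\<eta> \<bullet>c \<eta> = 1" using scale[OF \<xi>c] r by (simp add: \<eta>_def)
    moreover have "\<eta> \<in> orth_compl m (inv_vecs G m \<rho>)"
      using \<xi> \<eta>c inv by (auto simp: orth_compl_def \<eta>_def)
    moreover have "Re (finsum_vec TYPE(complex) m (\<lambda>s. \<rho> s *\<^sub>v \<eta>) S \<bullet>c \<eta>)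
        = 1 / r * Re (\<Sum>s\<in>S. (\<rho> s *\<^sub>v \<xi>) \<bullet>c \<xi>)" (is "?L = ?R")
    proof -
      have "finsum_vec TYPE(complex) m (\<lambda>s. \<rho> s *\<^sub>v \<eta>) S \<bullet>c \<eta> = (\<Sum>s\<in>S. (\<rho> s *\<^sub>v \<eta>) \<bullet>c \<eta>)"
        using S(1) \<eta>c mult_mat_vec_carrier[OF carr] by (intro finsum_vec_inner) auto
      also have "\<dots> = (\<Sum>s\<in>S. of_real (1 / r) * ((\<rho> s *\<^sub>v \<xi>) \<bullet>c \<xi>))"
      proof (rule sum.cong[OF refl])
        fix s assume s: "s \<in> S"
        have "\<rho> s *\<^sub>v \<eta> = c \<cdot>\<^sub>v (\<rho> s *\<^sub>v \<xi>)"
          unfolding \<eta>_def using mult_mat_vec[OF carr[OF s] \<xi>c] .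
        then show "(\<rho> s *\<^sub>v \<eta>) \<bullet>c \<eta> = of_real (1 / r) * ((\<rho> s *\<^sub>v \<xi>) \<bullet>c \<xi>)"
          using scale[OF mult_mat_vec_carrier[OF carr[OF s] \<xi>c]] by simp
      qed
      also have "\<dots> = of_real (1 / r) * (\<Sum>s\<in>S. (\<rho> s *\<^sub>v \<xi>) \<bullet>c \<xi>)"
        by (simp only: sum_distrib_left)
      finally show ?thesis by (simp only: Re_complex_of_real times_complex.sel Im_complex_of_real)
    qed
    ultimately have "ereal ?R \<le> (SUP \<xi> \<in> {\<xi> \<in> orth_compl m (inv_vecs G m \<rho>). \<xi> \<bullet>c \<xi> = 1}.
        ereal (Re (finsum_vec TYPE(complex) m (\<lambda>s. \<rho> s *\<^sub>v \<xi>) S \<bullet>c \<xi>)))"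
      by (intro SUP_upper2[of \<eta>]) auto
    then have "ereal (1 / real (card S)) * ereal ?R \<le> lambda_rep G m \<rho> S"
      unfolding lambda_rep_def by (intro ereal_mult_left_mono) auto
    \<comment> \<open>In the extended reals the value \<infinity> contradicts the gap hypothesis,
      and -\<infinity> satisfies the bound at once.\<close>
    moreover have "lambda_rep G m \<rho> S \<le> ereal (1 - \<epsilon>)"
      using \<epsilon> unfolding epsilon_rep_def one_ereal_def
      by (cases "lambda_rep G m \<rho> S") auto
    ultimately have "1 / real (card S) * ?R \<le> 1 - \<epsilon>"
      by (metis ereal_less_eq(3) order_trans times_ereal.simps(1))
    then show ?thesis using n r by (simp add: field_simps)
  qed
qed

text \<open>The gap is tested on \<open>X = mat_adjoint V * W\<close>, which carries the copy of
  \<tau> inside \<pi> to the copy of \<sigma>. Its squared norm is \<open>k\<close>, and moving it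
  by \<open>g\<close> yields the inner product
  \<open>mat_trace (\<sigma> g * mat_adjoint (\<tau> g))\<close>.\<close>

lemma gap_imp_trace_le:
  assumes \<pi>: "unitary_rep G m \<pi>" and S: "finite S" "S \<noteq> {}" "S \<subseteq> carrier G"
    and \<epsilon>: "ereal \<epsilon> \<le> epsilon_rep G (m * m) (tensor_rep \<pi> (conj_rep \<pi>)) S"
    and \<sigma>: "unitary_rep G k \<sigma>" and \<tau>: "unitary_rep G k \<tau>" and irr: "irreducible_rep G k \<tau>"
    and neq: "\<not> unitarily_equivalent G k \<tau> k \<sigma>"
    and V: "V \<in> carrier_mat k m" "V * mat_adjoint V = 1\<^sub>m k"
      "\<And>g. g \<in> carrier G \<Longrightarrow> V * \<pi> g = \<sigma> g * V"
    and W: "W \<in> carrier_mat k m" "W * mat_adjoint W = 1\<^sub>m k"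
      "\<And>g. g \<in> carrier G \<Longrightarrow> W * \<pi> g = \<tau> g * W"
  shows "Re (\<Sum>s\<in>S. mat_trace (\<sigma> s * mat_adjoint (\<tau> s))) \<le> (1 - \<epsilon>) * real (card S) * real k"
proof -
  let ?\<rho> = "tensor_rep \<pi> (conj_rep \<pi>)"
  define X where "X = mat_adjoint V * W"
  define \<xi> where "\<xi> = vec_of_mat m X"
  note Va = mat_adjoint_carrier[OF V(1)] and Wa = mat_adjoint_carrier[OF W(1)]
  have X: "X \<in> carrier_mat m m" unfolding X_def by (rule mult_carrier_mat[OF Va W(1)])
  have Xa: "mat_adjoint X = mat_adjoint W * V"
    unfolding X_def by (simp add: mat_adjoint_mult[OF Va W(1)])
  have act: "?\<rho> g *\<^sub>v vec_of_mat m Y = vec_of_mat m (\<pi> g * Y * mat_adjoint (\<pi> g))"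
    if "g \<in> carrier G" "Y \<in> carrier_mat m m" for g Y
    unfolding tensor_rep_def conj_rep_def
    using unitary_repD(1)[OF \<pi> that(1)] that(2) by (intro kronecker_mult_vec_of_mat)
  have orth: "\<xi> \<in> orth_compl (m * m) (inv_vecs G (m * m) ?\<rho>)"
    unfolding orth_compl_def
  proof (safe)
    show "\<xi> \<in> carrier_vec (m * m)" by (simp add: \<xi>_def)
    fix v assume v: "v \<in> inv_vecs G (m * m) ?\<rho>"
    then obtain Y where Y: "Y \<in> carrier_mat m m" "v = vec_of_mat m Y"
      by (auto simp: inv_vecs_def elim: ex_vec_of_mat)
    \<comment> \<open>Invariance under conjugation by a unitary is the same as commuting with
      it.\<close>
    have comm: "Y * \<pi> g = \<pi> g * Y" if g: "g \<in> carrier G" for g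
    proof -
      note p = unitary_repD[OF \<pi> g]
      note pY = mult_carrier_mat[OF p(1) Y(1)]
      have "\<pi> g * Y * mat_adjoint (\<pi> g) = Y"
      proof (rule vec_of_mat_inject)
        show "\<pi> g * Y * mat_adjoint (\<pi> g) \<in> carrier_mat m m"
          by (rule mult_carrier_mat[OF pY mat_adjoint_carrier[OF p(1)]])
        show "vec_of_mat m (\<pi> g * Y * mat_adjoint (\<pi> g)) = vec_of_mat m Y"
          using v Y g act[OF g Y(1)] by (simp add: inv_vecs_def)
      qed (rule Y)
      then have "Y * \<pi> g = \<pi> g * Y * mat_adjoint (\<pi> g) * \<pi> g" by simp
      also have "\<dots> = \<pi> g * Y"
        unfolding assoc_mult_mat[OF pY mat_adjoint_carrier[OF p(1)] p(1)] p(2) right_mult_one_mat[OF pY] ..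
      finally show ?thesis .
    qed
    \<comment> \<open>Cyclicity of the trace turns the inner product of \<open>Y\<close> and
      \<open>X\<close> into the trace of this \<open>Z\<close>, which intertwines \<tau> with
      \<sigma> and hence vanishes.\<close>
    define Z where "Z = V * Y * mat_adjoint W"
    note VY = mult_carrier_mat[OF V(1) Y(1)]
    have Z: "Z \<in> carrier_mat k k" unfolding Z_def by (rule mult_carrier_mat[OF VY Wa])
    have "Z = 0\<^sub>m k k"
    proof (rule schur_intertwiner_eq_zero[OF \<sigma> \<tau> irr Z _ neq])
      fix g assume g: "g \<in> carrier G"
      note p = unitary_repD[OF \<pi> g] and s = unitary_repD[OF \<sigma> g] and t = unitary_repD[OF \<tau> g]
      have "Z * \<tau> g = V * Y * (mat_adjoint W * \<tau> g)"
        unfolding Z_def by (rule assoc_mult_mat[OF VY Wa t(1)])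
      also have "mat_adjoint W * \<tau> g = \<pi> g * mat_adjoint W"
        using intertwiner_adjoint[OF p(4) t(4) W(1) W(3)[OF g]] ..
      also have "V * Y * (\<pi> g * mat_adjoint W) = V * (Y * \<pi> g) * mat_adjoint W"
        using assoc_mult_mat[OF VY p(1) Wa] assoc_mult_mat[OF V(1) Y(1) p(1)] by simp
      also have "\<dots> = V * \<pi> g * Y * mat_adjoint W"
        using assoc_mult_mat[OF V(1) p(1) Y(1)] comm[OF g] by simp
      also have "\<dots> = \<sigma> g * Z"
        using assoc_mult_mat[OF s(1) V(1) Y(1)] assoc_mult_mat[OF s(1) VY Wa] V(3)[OF g]
        by (simp add: Z_def)
      finally show "Z * \<tau> g = \<sigma> g * Z" .
    qed
    have "vec_of_mat m Y \<bullet>c \<xi> = mat_trace (Y * (mat_adjoint W * V))"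
      unfolding \<xi>_def vec_of_mat_inner[OF Y(1) X] Xa ..
    also have "\<dots> = mat_trace (Y * mat_adjoint W * V)"
      using assoc_mult_mat[OF Y(1) Wa V(1)] by simp
    also have "\<dots> = mat_trace Z"
      using mat_trace_comm[OF mult_carrier_mat[OF Y(1) Wa] V(1)] assoc_mult_mat[OF V(1) Y(1) Wa]
      by (simp add: Z_def)
    also have "\<dots> = 0" using \<open>Z = 0\<^sub>m k k\<close> by (simp add: mat_trace_zero)
    finally have "conjugate (v \<bullet>c \<xi>) = 0" using Y(2) by simp
    \<comment> \<open>The computation above has the arguments in the opposite order from
      \<open>orth_compl\<close>, hence the conjugation.\<close>
    moreover have "conjugate (v \<bullet>c \<xi>) = \<xi> \<bullet>c v"
      using conjugate_vec_sprod_comm[of v "m * m" \<xi>] conjugate_conjugate_sprod[of \<xi> "m * m" v]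
      by (simp add: Y(2) \<xi>_def)
    ultimately show "\<xi> \<bullet>c v = 0" by simp
  qed
  have norm: "\<xi> \<bullet>c \<xi> = of_nat k"
  proof -
    have "\<xi> \<bullet>c \<xi> = mat_trace (mat_adjoint V * W * (mat_adjoint W * V))"
      unfolding \<xi>_def vec_of_mat_inner[OF X X] Xa unfolding X_def ..
    also have "mat_adjoint V * W * (mat_adjoint W * V) = mat_adjoint V * (W * mat_adjoint W * V)"
      using assoc_mult_mat[OF Va W(1) mult_carrier_mat[OF Wa V(1)]]
        assoc_mult_mat[OF W(1) Wa V(1)] by simp
    also have "\<dots> = mat_adjoint V * V" unfolding W(2) left_mult_one_mat[OF V(1)] ..
    also have "mat_trace \<dots> = of_nat k"
      using mat_trace_comm[OF Va V(1)] by (simp add: V(2) mat_trace_one)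
    finally show ?thesis .
  qed
  have inner: "(?\<rho> g *\<^sub>v \<xi>) \<bullet>c \<xi> = mat_trace (\<sigma> g * mat_adjoint (\<tau> g))" if g: "g \<in> carrier G" for g
  proof -
    note p = unitary_repD[OF \<pi> g] and s = unitary_repD[OF \<sigma> g] and t = unitary_repD[OF \<tau> g]
    note pa = mat_adjoint_carrier[OF p(1)] and ta = mat_adjoint_carrier[OF t(1)]
    have 1: "\<pi> g * mat_adjoint V = mat_adjoint V * \<sigma> g"
      by (rule intertwiner_adjoint[OF p(4) s(4) V(1) V(3)[OF g]])
    have "\<pi> g * mat_adjoint W = mat_adjoint W * \<tau> g"
      by (rule intertwiner_adjoint[OF p(4) t(4) W(1) W(3)[OF g]])
    then have 2: "W * mat_adjoint (\<pi> g) = mat_adjoint (\<tau> g) * W"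
      using mat_adjoint_mult[OF p(1) Wa] mat_adjoint_mult[OF Wa t(1)] by simp
    define T where "T = \<sigma> g * mat_adjoint (\<tau> g)"
    have T: "T \<in> carrier_mat k k" unfolding T_def by (rule mult_carrier_mat[OF s(1) ta])
    have "\<pi> g * X * mat_adjoint (\<pi> g) = \<pi> g * mat_adjoint V * (W * mat_adjoint (\<pi> g))"
      unfolding X_def
      using assoc_mult_mat[OF p(1) Va W(1)] assoc_mult_mat[OF mult_carrier_mat[OF p(1) Va] W(1) pa]
      by simp
    also have "\<dots> = mat_adjoint V * (T * W)"
      unfolding 1 2 T_def
      using assoc_mult_mat[OF Va s(1) mult_carrier_mat[OF ta W(1)]] assoc_mult_mat[OF s(1) ta W(1)]
      by simp
    \<comment> \<open>Conjugation by \<open>\<pi> g\<close> inserts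
      \<open>T = \<sigma> g * mat_adjoint (\<tau> g)\<close> between \<open>mat_adjoint V\<close>
      and \<open>W\<close>. In the trace below, the coisometry relations for \<open>W\<close> and
      then \<open>V\<close> remove both maps.\<close>
    finally have eq: "\<pi> g * X * mat_adjoint (\<pi> g) = mat_adjoint V * (T * W)" .
    have TW: "T * W \<in> carrier_mat k m" by (rule mult_carrier_mat[OF T W(1)])
    have "(?\<rho> g *\<^sub>v \<xi>) \<bullet>c \<xi> = mat_trace (mat_adjoint V * (T * W) * (mat_adjoint W * V))"
      unfolding \<xi>_def act[OF g X] eq vec_of_mat_inner[OF mult_carrier_mat[OF Va TW] X] Xa ..
    also have "mat_adjoint V * (T * W) * (mat_adjoint W * V) =
        mat_adjoint V * (T * (W * mat_adjoint W) * V)"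
      using assoc_mult_mat[OF Va TW mult_carrier_mat[OF Wa V(1)]]
        assoc_mult_mat[OF TW Wa V(1)] assoc_mult_mat[OF T W(1) Wa] by simp
    also have "\<dots> = mat_adjoint V * (T * V)" unfolding W(2) right_mult_one_mat[OF T] ..
    also have "mat_trace \<dots> = mat_trace (T * V * mat_adjoint V)"
      by (rule mat_trace_comm[OF Va mult_carrier_mat[OF T V(1)]])
    also have "T * V * mat_adjoint V = T"
      unfolding assoc_mult_mat[OF T V(1) Va] V(2) right_mult_one_mat[OF T] ..
    finally show ?thesis by (simp add: T_def)
  qed
  have "?\<rho> s \<in> carrier_mat (m * m) (m * m)" if "s \<in> S" for s
    using unitary_repD(1)[OF \<pi>, of s] that S(3)
    by (auto simp: tensor_rep_def conj_rep_def kronecker_def)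
  from epsilon_rep_le_imp[OF S(1,2) \<epsilon> this orth] show ?thesis
    using inner S(3) by (simp add: norm subset_iff)
qed

section \<open>Coisometries onto the irreducible components\<close>

lemma diag_block_mat_carrier:
  assumes "\<And>s. s \<in> set L \<Longrightarrow> f s \<in> carrier_mat (k s) (k s)"
  shows "diag_block_mat (map f L) \<in> carrier_mat (sum_list (map k L)) (sum_list (map k L))"
  using assms
proof (induction L)
  case (Cons s L)
  then have "f s \<in> carrier_mat (k s) (k s)"
    "diag_block_mat (map f L) \<in> carrier_mat (sum_list (map k L)) (sum_list (map k L))" by simp_all
  then show ?case by (simp add: Let_def)
qed simp

text \<open>The offset \<open>a\<close> of a block is independent of \<open>g\<close>, which makes the inclusion of the block an
  intertwiner.\<close>

lemma diag_block_mat_block_offset: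
  assumes "t \<in> set L" and carr: "\<And>s g. s \<in> set L \<Longrightarrow> g \<in> C \<Longrightarrow> \<sigma> s g \<in> carrier_mat (k s) (k s)"
  shows "\<exists>a. a + k t \<le> sum_list (map k L) \<and>
    (\<forall>g\<in>C. \<forall>i<k t. \<forall>j<sum_list (map k L). diag_block_mat (map (\<lambda>s. \<sigma> s g) L) $$ (a + i, j) =
       (if a \<le> j \<and> j < a + k t then \<sigma> t g $$ (i, j - a) else 0))"
  using assms
proof (induction L)
  case Nil
  then show ?case by simp
next
  case (Cons s L)
  have dim: "dim_row (diag_block_mat (map (\<lambda>s. \<sigma> s g) L)) = sum_list (map k L)"
    "dim_col (diag_block_mat (map (\<lambda>s. \<sigma> s g) L)) = sum_list (map k L)" if "g \<in> C" for g
    using diag_block_mat_carrier[of L "\<lambda>s. \<sigma> s g" k] that Cons.prems(2) by simp_all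
  have c: "\<sigma> s g \<in> carrier_mat (k s) (k s)" if "g \<in> C" for g using Cons.prems(2) that by simp
  show ?case
  \<comment> \<open>Multiplicities make labels repeat in the list; the first block with label
    \<open>t\<close> is used.\<close>
  proof (cases "s = t")
    case True
    show ?thesis
    proof (intro exI[of _ 0] conjI ballI allI impI)
      fix g i j assume g: "g \<in> C" and i: "i < k t" and j: "j < sum_list (map k (s # L))"
      show "diag_block_mat (map (\<lambda>s. \<sigma> s g) (s # L)) $$ (0 + i, j) =
         (if 0 \<le> j \<and> j < 0 + k t then \<sigma> t g $$ (i, j - 0) else 0)"
        using c[OF g] dim[OF g] i j by (auto simp: Let_def True)
    qed (simp add: True)
  next
    case False
    then obtain a where a: "a + k t \<le> sum_list (map k L)"
      and eq: "\<And>g i j. g \<in> C \<Longrightarrow> i < k t \<Longrightarrow> j < sum_list (map k L) \<Longrightarrow>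
        diag_block_mat (map (\<lambda>s. \<sigma> s g) L) $$ (a + i, j) =
         (if a \<le> j \<and> j < a + k t then \<sigma> t g $$ (i, j - a) else 0)"
      using Cons by auto
    show ?thesis
    proof (intro exI[of _ "k s + a"] conjI ballI allI impI)
      fix g i j assume g: "g \<in> C" and i: "i < k t" and j: "j < sum_list (map k (s # L))"
      show "diag_block_mat (map (\<lambda>s. \<sigma> s g) (s # L)) $$ (k s + a + i, j) =
         (if k s + a \<le> j \<and> j < k s + a + k t then \<sigma> t g $$ (i, j - (k s + a)) else 0)"
        using c[OF g] dim[OF g] a i j eq[OF g i, of "j - k s"]
        by (auto simp: Let_def add.assoc)
    qed (use a in simp)
  qed
qed

text \<open>\<open>J\<close> is the coordinate projection onto one block of label \<open>t\<close>.
  It intertwines because the rows of that block vanish outside the block.\<close>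

lemma diag_block_mat_coisometry:
  fixes \<sigma> :: "nat \<Rightarrow> 'g \<Rightarrow> complex mat"
  assumes t: "t \<in> set L" and carr: "\<And>s g. s \<in> set L \<Longrightarrow> g \<in> C \<Longrightarrow> \<sigma> s g \<in> carrier_mat (k s) (k s)"
  defines "M \<equiv> sum_list (map k L)"
  shows "\<exists>J \<in> carrier_mat (k t) M. J * mat_adjoint J = 1\<^sub>m (k t) \<and>
    (\<forall>g\<in>C. J * diag_block_mat (map (\<lambda>s. \<sigma> s g) L) = \<sigma> t g * J)"
proof -
  obtain a where a: "a + k t \<le> M"
    and eq: "\<And>g i j. g \<in> C \<Longrightarrow> i < k t \<Longrightarrow> j < M \<Longrightarrow>
        diag_block_mat (map (\<lambda>s. \<sigma> s g) L) $$ (a + i, j) =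
         (if a \<le> j \<and> j < a + k t then \<sigma> t g $$ (i, j - a) else 0)"
    using diag_block_mat_block_offset[of t L C \<sigma> k, OF t carr] unfolding M_def by blast
  define J :: "complex mat" where "J = mat (k t) M (\<lambda>(i, j). if j = a + i then 1 else 0)"
  have J: "J \<in> carrier_mat (k t) M" by (simp add: J_def)
  have dim: "diag_block_mat (map (\<lambda>s. \<sigma> s g) L) \<in> carrier_mat M M" if "g \<in> C" for g
    using that carr unfolding M_def by (intro diag_block_mat_carrier)
  have "J * mat_adjoint J = 1\<^sub>m (k t)"
    using a by (intro eq_matI) (auto simp: J_def scalar_prod_def if_distrib[of "\<lambda>x. x * _"] cong: if_cong)
  moreover have "J * diag_block_mat (map (\<lambda>s. \<sigma> s g) L) = \<sigma> t g * J" if g: "g \<in> C" for g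
  proof (rule eq_matI)
    note c = carr[OF t g]
    fix i j assume "i < dim_row (\<sigma> t g * J)" "j < dim_col (\<sigma> t g * J)"
    then have ij: "i < k t" "j < M" using c by (auto simp: J_def)
    have "(J * diag_block_mat (map (\<lambda>s. \<sigma> s g) L)) $$ (i, j) =
        (\<Sum>p<M. if p = a + i then diag_block_mat (map (\<lambda>s. \<sigma> s g) L) $$ (p, j) else 0)"
      using ij a dim[OF g]
      by (simp add: J_def scalar_prod_def lessThan_atLeast0 if_distrib[of "\<lambda>x. x * _"] cong: if_cong)
    also have "\<dots> = (if a \<le> j \<and> j < a + k t then \<sigma> t g $$ (i, j - a) else 0)"
      using ij a eq[OF g ij] by simp
    \<comment> \<open>The inner condition \<open>a \<le> j\<close> is essential: for
      \<open>j < a\<close> the truncated difference \<open>j - a\<close> is 0 and would pick a wrong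
      entry.\<close>
    also have "\<dots> = (\<Sum>p<k t. if p = j - a then (if a \<le> j then \<sigma> t g $$ (i, p) else 0) else 0)"
      using ij by auto
    also have "\<dots> = (\<Sum>p<k t. \<sigma> t g $$ (i, p) * (if j = a + p then 1 else 0))"
      by (intro sum.cong) auto
    also have "\<dots> = (\<sigma> t g * J) $$ (i, j)"
      using ij c by (simp add: J_def scalar_prod_def lessThan_atLeast0)
    finally show "(J * diag_block_mat (map (\<lambda>s. \<sigma> s g) L)) $$ (i, j) = (\<sigma> t g * J) $$ (i, j)" .
  qed (use carr[OF t g] dim[OF g] in \<open>auto simp: J_def\<close>)
  ultimately show ?thesis using J by blast
qed

lemma direct_sum_conv:
  "direct_sum T d \<sigma> g =
     diag_block_mat (map (\<lambda>t. \<sigma> t g) (concat (map (\<lambda>t. replicate (d t) t) (sorted_list_of_set T))))"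
  by (simp add: direct_sum_def map_concat comp_def)

text \<open>Compose the unitary \<open>U\<close> that realises the decomposition with the projection
  \<open>J\<close> onto a block.\<close>

lemma irreducible_decomposition_coisometry:
  assumes G: "group G" and \<pi>: "unitary_rep G m \<pi>"
    and dec: "irreducible_decomposition G m \<pi> T k \<sigma> d" and t: "t \<in> T"
  shows "\<exists>V \<in> carrier_mat (k t) m. V * mat_adjoint V = 1\<^sub>m (k t) \<and>
    (\<forall>g\<in>carrier G. V * \<pi> g = \<sigma> t g * V)"
proof -
  interpret group G by (rule G)
  define L where "L = concat (map (\<lambda>t. replicate (d t) t) (sorted_list_of_set T))"
  define M where "M = sum_list (map k L)"
  let ?D = "\<lambda>g. diag_block_mat (map (\<lambda>s. \<sigma> s g) L)"
  have fin: "finite T" using dec by (simp add: irreducible_decomposition_def)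
  have rep: "unitary_rep G (k s) (\<sigma> s)" "1 \<le> d s" if "s \<in> T" for s
    using dec that by (simp_all add: irreducible_decomposition_def)
  have L: "set L = T"
    using fin rep(2) by (force simp: L_def)
  have carr: "\<sigma> s g \<in> carrier_mat (k s) (k s)" if "s \<in> set L" "g \<in> carrier G" for s g
    using unitary_repD(1)[OF rep(1)] that L by simp
  obtain J where J: "J \<in> carrier_mat (k t) M" "J * mat_adjoint J = 1\<^sub>m (k t)"
      "\<And>g. g \<in> carrier G \<Longrightarrow> J * ?D g = \<sigma> t g * J"
    using diag_block_mat_coisometry[of t L "carrier G" \<sigma> k] t carr L unfolding M_def by blast
  obtain U where U: "unitary_mat m U" "\<And>g. g \<in> carrier G \<Longrightarrow> U * \<pi> g = ?D g * U"
    using dec by (auto simp: irreducible_decomposition_def unitarily_equivalent_def direct_sum_conv L_def)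
  have Uc: "U \<in> carrier_mat m m" "U * mat_adjoint U = 1\<^sub>m m" using U(1) by (auto simp: unitary_mat_def)
  have dim: "?D g \<in> carrier_mat M M" if "g \<in> carrier G" for g
    using that carr unfolding M_def by (intro diag_block_mat_carrier)
  \<comment> \<open>Comparing the row dimensions in the intertwining relation at the identity avoids
    evaluating the list sum \<open>M\<close>.\<close>
  have "M = m"
    using arg_cong[OF U(2)[OF one_closed], of dim_row] Uc(1) dim[OF one_closed] by simp
  note J = J[unfolded \<open>M = m\<close>] and dim = dim[unfolded \<open>M = m\<close>]
  note Ja = mat_adjoint_carrier[OF J(1)] and Ua = mat_adjoint_carrier[OF Uc(1)]
  show ?thesis
  proof (intro bexI[of _ "J * U"] conjI ballI)
    have "J * U * mat_adjoint (J * U) = J * (U * mat_adjoint U * mat_adjoint J)"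
      unfolding mat_adjoint_mult[OF J(1) Uc(1)]
      using assoc_mult_mat[OF J(1) Uc(1) mult_carrier_mat[OF Ua Ja]]
        assoc_mult_mat[OF Uc(1) Ua Ja] by simp
    then show "J * U * mat_adjoint (J * U) = 1\<^sub>m (k t)"
      unfolding Uc(2) left_mult_one_mat[OF Ja] J(2) .
  next
    fix g assume g: "g \<in> carrier G"
    note p = unitary_repD(1)[OF \<pi> g] and s = carr[of t, unfolded L, OF t g]
    show "J * U * \<pi> g = \<sigma> t g * (J * U)"
      using assoc_mult_mat[OF J(1) Uc(1) p] assoc_mult_mat[OF J(1) dim[OF g] Uc(1)]
        assoc_mult_mat[OF s J(1) Uc(1)] U(2)[OF g] J(3)[OF g] by simp
  qed (rule mult_carrier_mat[OF J(1) Uc(1)])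
qed

section \<open>Counting the irreducible components\<close>

lemma card_components_of_dim_le:
  fixes G :: "'g monoid"
  assumes G: "group G" and \<pi>: "unitary_rep G m \<pi>"
    and S: "S \<subseteq> carrier G" "finite S" "S \<noteq> {}" and "0 < \<epsilon>"
    and gap: "ereal \<epsilon> \<le> epsilon_rep G (m * m) (tensor_rep \<pi> (conj_rep \<pi>)) S"
    and dec: "irreducible_decomposition G m \<pi> T k \<sigma> d" and "0 < l"
  shows "real (card {t \<in> T. k t = l}) \<le> exp ((8 / \<epsilon> + 4) * real (card S) * (real l)\<^sup>2)"
proof -
  define n where "n = card S"
  have n: "0 < n" using S by (simp add: n_def card_gt_0_iff)
  let ?A = "{t \<in> T. k t = l}"
  define I where "I = S \<times> {..<l} \<times> {..<l} \<times> (UNIV :: bool set)"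
  \<comment> \<open>The point attached to \<open>t\<close> lists the real and imaginary parts of all
    entries of \<open>\<sigma> t g\<close> for \<open>g \<in> S\<close>. Its squared norm is
    \<open>n * l\<close> by unitarity.\<close>
  define x where "x t = (\<lambda>(g, i, j, b). if b then Re (\<sigma> t g $$ (i, j)) else Im (\<sigma> t g $$ (i, j)))" for t
  have rep: "unitary_rep G l (\<sigma> t)" "irreducible_rep G l (\<sigma> t)" if "t \<in> ?A" for t
    using dec that by (auto simp: irreducible_decomposition_def)
  have carr: "\<sigma> t g \<in> carrier_mat l l" if "t \<in> ?A" "g \<in> S" for t g
    using unitary_repD(1)[OF rep(1)[OF that(1)]] that S(1) by blast
  have inner: "(\<Sum>i\<in>I. x s i * x t i) = Re (\<Sum>g\<in>S. mat_trace (\<sigma> s g * mat_adjoint (\<sigma> t g)))"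
    if st: "s \<in> ?A" "t \<in> ?A" for s t
  proof -
    have "(\<Sum>i\<in>I. x s i * x t i) =
        (\<Sum>g\<in>S. \<Sum>i<l. \<Sum>j<l. \<Sum>b\<in>UNIV. x s (g, i, j, b) * x t (g, i, j, b))"
      unfolding I_def sum.cartesian_product by (simp add: case_prod_unfold)
    also have "\<dots> =
        (\<Sum>g\<in>S. \<Sum>i<l. \<Sum>j<l. Re (\<sigma> s g $$ (i, j) * cnj (\<sigma> t g $$ (i, j))))"
      by (simp add: x_def UNIV_bool add.commute)
    also have "\<dots> = Re (\<Sum>g\<in>S. mat_trace (\<sigma> s g * mat_adjoint (\<sigma> t g)))"
      by (simp add: Re_sum mat_trace_mult_adjoint[OF carr[OF st(1)] carr[OF st(2)]])
    finally show ?thesis .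
  qed
  have norm: "(\<Sum>i\<in>I. (x t i)\<^sup>2) = real n * real l" if t: "t \<in> ?A" for t
  proof -
    have "mat_trace (\<sigma> t g * mat_adjoint (\<sigma> t g)) = of_nat l" if "g \<in> S" for g
      using unitary_repD(3)[OF rep(1)[OF t], of g] that S(1) by (auto simp: mat_trace_one)
    then show ?thesis using inner[OF t t] by (simp add: power2_eq_square n_def)
  qed
  have "real (card ?A) \<le> exp ((4 / \<epsilon> + 2) * real (card I))"
  proof (rule card_separated_le_exp[where x = x and R = "real n * real l"])
    show "finite I" using S(2) by (simp add: I_def)
    show "I \<noteq> {}" using S(3) \<open>0 < l\<close> by (auto simp: I_def)
    show "0 < real n * real l" using n \<open>0 < l\<close> by simp
    show "0 < \<epsilon>" by fact
    show "(\<Sum>i\<in>I. (x t i)\<^sup>2) \<le> real n * real l" if "t \<in> ?A" for t using norm[OF that] by simp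
  next
    fix s t assume st: "s \<in> ?A" "t \<in> ?A" "s \<noteq> t"
    then have T: "s \<in> T" "t \<in> T" and k: "k s = l" "k t = l" by auto
    obtain V where V: "V \<in> carrier_mat l m" "V * mat_adjoint V = 1\<^sub>m l"
        "\<And>g. g \<in> carrier G \<Longrightarrow> V * \<pi> g = \<sigma> s g * V"
      using irreducible_decomposition_coisometry[OF G \<pi> dec T(1)] unfolding k by blast
    obtain W where W: "W \<in> carrier_mat l m" "W * mat_adjoint W = 1\<^sub>m l"
        "\<And>g. g \<in> carrier G \<Longrightarrow> W * \<pi> g = \<sigma> t g * W"
      using irreducible_decomposition_coisometry[OF G \<pi> dec T(2)] unfolding k by blast
    have "\<not> unitarily_equivalent G l (\<sigma> t) l (\<sigma> s)"
      using dec T k st(3) unfolding irreducible_decomposition_def by metis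
    then have "(\<Sum>i\<in>I. x s i * x t i) \<le> (1 - \<epsilon>) * real n * real l"
      unfolding inner[OF st(1,2)] n_def
      by (intro gap_imp_trace_le[OF \<pi> S(2,3,1) gap rep(1)[OF st(1)] rep[OF st(2)] _ V W])
    \<comment> \<open>Both squared norms are \<open>n * l\<close>, so the squared distance is at
      least \<open>2 * n * l - 2 * (1 - \<epsilon>) * n * l\<close>.\<close>
    moreover have "(\<Sum>i\<in>I. (x s i - x t i)\<^sup>2) =
        (\<Sum>i\<in>I. (x s i)\<^sup>2) + (\<Sum>i\<in>I. (x t i)\<^sup>2) - 2 * (\<Sum>i\<in>I. x s i * x t i)"
      by (simp add: power2_diff sum.distrib sum_subtractf sum_distrib_left mult.assoc)
    ultimately show "2 * \<epsilon> * (real n * real l) \<le> (\<Sum>i\<in>I. (x s i - x t i)\<^sup>2)"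
      using norm[OF st(1)] norm[OF st(2)] by (simp add: algebra_simps)
  qed
  \<comment> \<open>The factor 2 for real and imaginary parts turns
    \<open>4 / \<epsilon> + 2\<close> into \<open>8 / \<epsilon> + 4\<close>.\<close>
  also have "real (card I) = 2 * real n * (real l)\<^sup>2"
    by (simp add: I_def n_def card_cartesian_product power2_eq_square)
  finally show ?thesis by (simp add: n_def algebra_simps)
qed

text \<open>Each dimension \<open>l \<le> N\<close> contributes at most the bound for
  \<open>N\<close>. The additional 1 in the constant absorbs the number \<open>N\<close> of
  dimensions.\<close>

lemma bound_holds_explicit:
  assumes "0 < \<epsilon>"
  shows "bound_holds TYPE('g) \<epsilon> (8 / \<epsilon> + 5)"
  unfolding bound_holds_def
proof (intro allI impI)
  fix G :: "'g monoid" and m \<pi> S T k \<sigma> d N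
  assume G: "group G" and \<pi>: "unitary_rep G m \<pi>"
    and S: "S \<subseteq> carrier G" "finite S" "S \<noteq> {}"
    and gap: "ereal \<epsilon> \<le> epsilon_rep G (m * m) (tensor_rep \<pi> (conj_rep \<pi>)) S"
    and dec: "irreducible_decomposition G m \<pi> T k \<sigma> d" and N: "1 \<le> (N::nat)"
  define n where "n = card S"
  have n: "1 \<le> n" using S by (simp add: n_def Suc_le_eq card_gt_0_iff)
  let ?c = "8 / \<epsilon> + 4"
  have pos: "0 < k t" if "t \<in> T" for t
    using dec that by (simp add: irreducible_decomposition_def irreducible_rep_def)
  have "{t \<in> T. k t \<le> N} = (\<Union>l\<in>{1..N}. {t \<in> T. k t = l})"
    using pos by force
  then have "card {t \<in> T. k t \<le> N} \<le> (\<Sum>l\<in>{1..N}. card {t \<in> T. k t = l})"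
    by (simp only:) (rule card_UN_le, simp)
  then have "real (card {t \<in> T. k t \<le> N}) \<le> (\<Sum>l\<in>{1..N}. real (card {t \<in> T. k t = l}))"
    by (simp flip: of_nat_sum)
  also have "\<dots> \<le> (\<Sum>l\<in>{1..N}. exp (?c * real n * (real N)\<^sup>2))"
  proof (rule sum_mono)
    fix l assume l: "l \<in> {1..N}"
    then have "real (card {t \<in> T. k t = l}) \<le> exp (?c * real n * (real l)\<^sup>2)"
      unfolding n_def by (intro card_components_of_dim_le[OF G \<pi> S assms gap dec]) simp
    also have "\<dots> \<le> exp (?c * real n * (real N)\<^sup>2)"
      using l assms by (auto intro!: mult_left_mono power_mono)
    finally show "real (card {t \<in> T. k t = l}) \<le> exp (?c * real n * (real N)\<^sup>2)" .
  qed
  also have "\<dots> = real N * exp (?c * real n * (real N)\<^sup>2)" by simp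
  also have "\<dots> \<le> exp (real n * (real N)\<^sup>2) * exp (?c * real n * (real N)\<^sup>2)"
  proof (intro mult_right_mono)
    \<comment> \<open>With \<open>n\<close> and \<open>N\<close> at least 1,
      \<open>N \<le> n * N\<^sup>2 \<le> exp (n * N\<^sup>2)\<close>.\<close>
    have "real N \<le> real n * (real N * real N)"
      using n N by (metis le_square mult_le_mono nat_mult_1 of_nat_le_iff of_nat_mult)
    then show "real N \<le> exp (real n * (real N)\<^sup>2)"
      using exp_ge_add_one_self[of "real n * (real N)\<^sup>2"] unfolding power2_eq_square by linarith
  qed simp
  also have "\<dots> = exp ((8 / \<epsilon> + 5) * real n * (real N)\<^sup>2)"
    by (simp add: algebra_simps flip: exp_add)
  finally show "real (card {t \<in> T. k t \<le> N}) \<le> exp ((8 / \<epsilon> + 5) * real (card S) * (real N)\<^sup>2)"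
    by (simp only: n_def)
qed

section \<open>Reduction to countable groups\<close>

lemma sum_fun_apply:
  fixes f :: "'a \<Rightarrow> 'b \<Rightarrow> 'c :: comm_monoid_add"
  shows "(\<Sum>a\<in>A. f a) i = (\<Sum>a\<in>A. f a i)"
  by (induction A rule: infinite_finite_induct) auto

text \<open>The functions restricted to \<open>I\<close> live in a space of finite dimension, so a
  maximal independent set of them is finite; \<open>F\<close> picks one preimage for each. The
  coefficients \<open>c\<close> serve all indices of \<open>I\<close> simultaneously.\<close>

lemma ex_finite_spanning_subfamily:
  fixes x :: "'a \<Rightarrow> 'i \<Rightarrow> complex"
  assumes "finite I"
  shows "\<exists>F\<subseteq>A. finite F \<and> (\<forall>g\<in>A. \<exists>c. \<forall>i\<in>I. x g i = (\<Sum>f\<in>F. c f * x f i))"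
proof -
  interpret V: vector_space "\<lambda>(c :: complex) (f :: 'i \<Rightarrow> complex) i. c * f i"
    by unfold_locales (auto simp: algebra_simps fun_eq_iff)
  \<comment> \<open>Cutting off outside \<open>I\<close> places all functions in the span of the
    finitely many \<open>e i\<close>.\<close>
  define y where "y g = (\<lambda>i. if i \<in> I then x g i else 0)" for g
  define e :: "'i \<Rightarrow> 'i \<Rightarrow> complex" where "e i = (\<lambda>j. if j = i then 1 else 0)" for i
  obtain B where B: "B \<subseteq> y ` A" "V.independent B" "y ` A \<subseteq> V.span B"
    using V.maximal_independent_subset by blast
  have "y g \<in> V.span (e ` I)" for g
  proof -
    have "y g = (\<Sum>i\<in>I. (\<lambda>j. x g i * e i j))"
      using assms by (auto simp: y_def e_def sum_fun_apply fun_eq_iff if_distrib[of "\<lambda>z. _ * z"] cong: if_cong)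
    also have "\<dots> \<in> V.span (e ` I)"
      by (intro V.span_sum V.span_scale V.span_base) simp
    finally show ?thesis .
  qed
  then have "finite B"
    using V.independent_span_bound[of "e ` I" B] assms B(1,2) by blast
  obtain F where F: "F \<subseteq> A" "inj_on y F" "B = y ` F"
    using B(1) by (auto simp: subset_image_inj)
  have "finite F" using F \<open>finite B\<close> by (simp add: finite_image_iff)
  moreover have "\<exists>c. \<forall>i\<in>I. x g i = (\<Sum>f\<in>F. c f * x f i)" if "g \<in> A" for g
  proof -
    have "y g \<in> V.span B" using B(3) that by blast
    then obtain u where "y g = (\<Sum>v\<in>B. (\<lambda>i. u v * v i))"
      unfolding V.span_finite[OF \<open>finite B\<close>] by (elim rangeE) (rule that)
    then have "y g = (\<Sum>f\<in>F. (\<lambda>i. u (y f) * y f i))"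
      by (simp add: F(3) sum.reindex[OF F(2)])
    then have "y g i = (\<Sum>f\<in>F. u (y f) * y f i)" for i by (simp add: sum_fun_apply)
    then have "x g i = (\<Sum>f\<in>F. u (y f) * x f i)" if "i \<in> I" for i
      using that by (metis (mono_tags, lifting) y_def sum.cong)
    then show ?thesis by (intro exI[of _ "\<lambda>f. u (y f)"]) simp
  qed
  ultimately show ?thesis using F(1) by blast
qed

text \<open>Every generated element is the value \<open>w xs\<close> of a word over the countable
  alphabet of generators and their inverses.\<close>

lemma countable_generate:
  assumes "group G" "A \<subseteq> carrier G" "countable A"
  shows "countable (generate G A)"
proof -
  interpret group G by fact
  define X where "X = A \<union> m_inv G ` A"
  define w where "w xs = foldr (\<otimes>\<^bsub>G\<^esub>) xs \<one>\<^bsub>G\<^esub>" for xs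
  have X: "X \<subseteq> carrier G" "countable X" using assms by (auto simp: X_def)
  have closed: "w xs \<in> carrier G" if "xs \<in> lists X" for xs
    using that X(1) unfolding w_def by (induction xs) auto
  have append: "w (xs @ ys) = w xs \<otimes>\<^bsub>G\<^esub> w ys" if "xs \<in> lists X" "ys \<in> lists X" for xs ys
    using that(1)
  proof (induction xs)
    case Nil
    then show ?case using closed[OF that(2)] by (simp add: w_def)
  next
    case (Cons x xs)
    then have "x \<in> carrier G" "w xs \<in> carrier G" using X(1) closed by auto
    then show ?case using Cons.IH closed[OF that(2)] by (simp add: w_def m_assoc)
  qed
  have single: "w [x] = x" if "x \<in> X" for x using that X(1) by (auto simp: w_def)
  have "h \<in> w ` lists X" if "h \<in> generate G A" for h
    using that
  proof induction
    case one
    show ?case by (rule image_eqI[of _ _ "[]"]) (auto simp: w_def)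
  next
    case (incl h)
    then show ?case using single[of h] by (intro image_eqI[of _ _ "[h]"]) (auto simp: X_def)
  next
    case (inv h)
    then show ?case using single[of "inv\<^bsub>G\<^esub> h"]
      by (intro image_eqI[of _ _ "[inv\<^bsub>G\<^esub> h]"]) (auto simp: X_def)
  next
    case (eng h1 h2)
    then obtain xs ys where "xs \<in> lists X" "ys \<in> lists X" "h1 = w xs" "h2 = w ys" by blast
    then show ?case by (intro image_eqI[of _ _ "xs @ ys"]) (auto simp: append)
  qed
  then have "generate G A \<subseteq> w ` lists X" by blast
  moreover have "countable (w ` lists X)" using X(2) by simp
  ultimately show ?thesis by (rule countable_subset)
qed

text \<open>The multiplication of \<open>H\<close> is transported along an injection into the
  natural numbers. The carrier is its image, so finite \<open>H\<close> is covered too.\<close>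

lemma countable_subgroup_ex_nat_group:
  fixes G :: "'g monoid"
  assumes "subgroup H G" "group G" "countable H"
  obtains K :: "nat monoid" and \<phi>
  where "group K" "\<phi> \<in> hom K G" "inj_on \<phi> (carrier K)" "\<phi> ` carrier K = H"
proof -
  interpret G: group G by fact
  interpret H: subgroup H G by fact
  define e where "e = to_nat_on H"
  define \<phi> where "\<phi> = inv_into H e"
  have \<phi>e: "\<phi> (e h) = h" if "h \<in> H" for h
    unfolding e_def \<phi>_def using inj_on_to_nat_on[OF assms(3)] that by (rule inv_into_f_f)
  define K :: "nat monoid" where
    "K = \<lparr>carrier = e ` H, monoid.mult = (\<lambda>a b. e (\<phi> a \<otimes>\<^bsub>G\<^esub> \<phi> b)), one = e \<one>\<^bsub>G\<^esub>\<rparr>"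
  have "group K"
  proof (rule groupI)
    fix a assume "a \<in> carrier K"
    then obtain h where h: "h \<in> H" "a = e h" by (auto simp: K_def)
    then show "\<exists>b\<in>carrier K. b \<otimes>\<^bsub>K\<^esub> a = \<one>\<^bsub>K\<^esub>"
      by (intro bexI[of _ "e (inv\<^bsub>G\<^esub> h)"]) (auto simp: K_def \<phi>e)
  qed (auto simp: K_def \<phi>e G.m_assoc)
  moreover have "\<phi> \<in> hom K G" by (auto simp: hom_def K_def \<phi>e)
  moreover have "inj_on \<phi> (carrier K)" by (auto simp: inj_on_def K_def \<phi>e)
  moreover have "\<phi> ` carrier K = H" by (force simp: K_def \<phi>e)
  ultimately show ?thesis using that by blast
qed

section \<open>Restriction of representations along a homomorphism\<close>

lemma unitary_rep_comp:
  assumes "unitary_rep G m \<rho>" "\<phi> \<in> hom K G"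
  shows "unitary_rep K m (\<rho> \<circ> \<phi>)"
  using assms unfolding unitary_rep_def by (rule hom_compose[rotated])

text \<open>Passing to a subgroup adds invariant vectors, so the supremum runs over fewer vectors.\<close>

lemma epsilon_rep_le_comp:
  assumes hom: "\<phi> \<in> hom K G" and S: "finite S" "S \<subseteq> carrier K" "inj_on \<phi> S"
    and carr: "\<And>s. s \<in> \<phi> ` S \<Longrightarrow> \<rho> s \<in> carrier_mat m m"
  shows "epsilon_rep G m \<rho> (\<phi> ` S) \<le> epsilon_rep K m (\<rho> \<circ> \<phi>) S"
proof -
  have "inv_vecs G m \<rho> \<subseteq> inv_vecs K m (\<rho> \<circ> \<phi>)"
    using hom by (auto simp: inv_vecs_def hom_def)
  then have sub: "orth_compl m (inv_vecs K m (\<rho> \<circ> \<phi>)) \<subseteq> orth_compl m (inv_vecs G m \<rho>)"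
    by (auto simp: orth_compl_def)
  have eq: "finsum_vec TYPE(complex) m (\<lambda>s. (\<rho> \<circ> \<phi>) s *\<^sub>v \<xi>) S \<bullet>c \<xi> =
      finsum_vec TYPE(complex) m (\<lambda>s. \<rho> s *\<^sub>v \<xi>) (\<phi> ` S) \<bullet>c \<xi>" if "\<xi> \<in> carrier_vec m" for \<xi>
  proof -
    have "finsum_vec TYPE(complex) m (\<lambda>s. (\<rho> \<circ> \<phi>) s *\<^sub>v \<xi>) S \<bullet>c \<xi> =
        (\<Sum>s\<in>S. ((\<rho> \<circ> \<phi>) s *\<^sub>v \<xi>) \<bullet>c \<xi>)"
      using S(1) that mult_mat_vec_carrier[OF carr that] by (intro finsum_vec_inner) auto
    moreover have "finsum_vec TYPE(complex) m (\<lambda>s. \<rho> s *\<^sub>v \<xi>) (\<phi> ` S) \<bullet>c \<xi> =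
        (\<Sum>s\<in>\<phi> ` S. (\<rho> s *\<^sub>v \<xi>) \<bullet>c \<xi>)"
      using S(1) that mult_mat_vec_carrier[OF carr that] by (intro finsum_vec_inner) auto
    ultimately show ?thesis by (simp add: sum.reindex[OF S(3)])
  qed
  \<comment> \<open>Injectivity on \<open>S\<close> preserves the cardinality in the normalising
    factor as well as the sum.\<close>
  have "lambda_rep K m (\<rho> \<circ> \<phi>) S \<le> lambda_rep G m \<rho> (\<phi> ` S)"
    unfolding lambda_rep_def card_image[OF S(3)]
  proof (intro ereal_mult_left_mono SUP_subset_mono)
    show "{\<xi> \<in> orth_compl m (inv_vecs K m (\<rho> \<circ> \<phi>)). \<xi> \<bullet>c \<xi> = 1}
        \<subseteq> {\<xi> \<in> orth_compl m (inv_vecs G m \<rho>). \<xi> \<bullet>c \<xi> = 1}" using sub by blast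
    fix \<xi> assume "\<xi> \<in> {\<xi> \<in> orth_compl m (inv_vecs K m (\<rho> \<circ> \<phi>)). \<xi> \<bullet>c \<xi> = 1}"
    then have "\<xi> \<in> carrier_vec m" by (simp add: orth_compl_def)
    from eq[OF this]
    show "ereal (Re (finsum_vec TYPE(complex) m (\<lambda>s. (\<rho> \<circ> \<phi>) s *\<^sub>v \<xi>) S \<bullet>c \<xi>))
        \<le> ereal (Re (finsum_vec TYPE(complex) m (\<lambda>s. \<rho> s *\<^sub>v \<xi>) (\<phi> ` S) \<bullet>c \<xi>))" by simp
  qed simp
  then show ?thesis unfolding epsilon_rep_def by (intro ereal_minus_mono) auto
qed

lemma subspace_lincomb:
  assumes W: "VectorSpace.subspace class_ring W (module_vec TYPE(complex) k)"
    and "finite F" "\<And>f. f \<in> F \<Longrightarrow> w f \<in> W"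
  shows "vec k (\<lambda>i. \<Sum>f\<in>F. c f * w f $ i) \<in> W"
  using assms(2,3)
proof (induction F rule: finite_induct)
  have sub: "submodule class_ring W (module_vec TYPE(complex) k)"
    using W by (simp add: VectorSpace.subspace_def)
  note W' = submodule.subset[OF sub] submodule.m_closed[OF sub] submodule.zero_closed[OF sub]
    submodule.smult_closed[OF sub]
  note W = W'[unfolded module_vec_simps class_ring_simps, simplified]
  {
    case empty
    have "vec k (\<lambda>i. \<Sum>f\<in>{}. c f * w f $ i) = 0\<^sub>v k" by (intro eq_vecI) auto
    then show ?case using W(3) by simp
  next
    case (insert f F)
    have wf: "w f \<in> carrier_vec k" using insert.prems W(1) by blast
    have "vec k (\<lambda>i. \<Sum>f\<in>insert f F. c f * w f $ i) =
        c f \<cdot>\<^sub>v w f + vec k (\<lambda>i. \<Sum>f\<in>F. c f * w f $ i)"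
      using insert.hyps wf by (intro eq_vecI) auto
    then show ?case using insert W(2,4) by simp
  }
qed

text \<open>Each \<open>\<sigma> g\<close> is a linear combination of operators
  \<open>\<sigma> f\<close> with \<open>f\<close> in the image of \<phi>, so a subspace invariant
  under \<open>K\<close> is already invariant under \<open>G\<close>.\<close>

lemma irreducible_rep_comp:
  assumes irr: "irreducible_rep G k \<sigma>" and \<sigma>: "unitary_rep G k \<sigma>"
    and F: "finite F" "F \<subseteq> \<phi> ` carrier K" "F \<subseteq> carrier G"
    and span: "\<And>g. g \<in> carrier G \<Longrightarrow>
      \<exists>c. \<forall>i<k. \<forall>j<k. \<sigma> g $$ (i, j) = (\<Sum>f\<in>F. c f * \<sigma> f $$ (i, j))"
  shows "irreducible_rep K k (\<sigma> \<circ> \<phi>)"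
  unfolding irreducible_rep_def
proof (intro conjI allI impI)
  show "0 < k" using irr by (simp add: irreducible_rep_def)
  fix W assume W: "VectorSpace.subspace class_ring W (module_vec TYPE(complex) k)"
    and inv: "\<forall>g\<in>carrier K. \<forall>w\<in>W. (\<sigma> \<circ> \<phi>) g *\<^sub>v w \<in> W"
  have Wc: "W \<subseteq> carrier_vec k"
    using W submodule.subset[of class_ring W "module_vec TYPE(complex) k"]
    by (simp add: VectorSpace.subspace_def module_vec_simps)
  have "\<sigma> g *\<^sub>v w \<in> W" if g: "g \<in> carrier G" and w: "w \<in> W" for g w
  proof -
    obtain c where c: "\<And>i j. i < k \<Longrightarrow> j < k \<Longrightarrow> \<sigma> g $$ (i, j) = (\<Sum>f\<in>F. c f * \<sigma> f $$ (i, j))"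
      using span[OF g] by blast
    have wc: "w \<in> carrier_vec k" using w Wc by blast
    have \<sigma>f: "\<sigma> f \<in> carrier_mat k k" if "f \<in> F" for f
      using that F(3) unitary_repD(1)[OF \<sigma>] by blast
    have "\<sigma> g *\<^sub>v w = vec k (\<lambda>i. \<Sum>f\<in>F. c f * (\<sigma> f *\<^sub>v w) $ i)"
    proof (rule eq_vecI)
      fix i assume "i < dim_vec (vec k (\<lambda>i. \<Sum>f\<in>F. c f * (\<sigma> f *\<^sub>v w) $ i))"
      then have i: "i < k" by simp
      have "(\<sigma> g *\<^sub>v w) $ i = (\<Sum>j<k. \<Sum>f\<in>F. c f * (\<sigma> f $$ (i, j) * w $ j))"
        using i wc unitary_repD(1)[OF \<sigma> g]
        by (simp add: scalar_prod_def lessThan_atLeast0 c sum_distrib_right mult.assoc)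
      also have "\<dots> = (\<Sum>f\<in>F. c f * (\<Sum>j<k. \<sigma> f $$ (i, j) * w $ j))"
        by (subst sum.swap) (simp add: sum_distrib_left)
      also have "\<dots> = (\<Sum>f\<in>F. c f * (\<sigma> f *\<^sub>v w) $ i)"
      proof (rule sum.cong[OF refl])
        fix f assume "f \<in> F"
        from \<sigma>f[OF this] show "c f * (\<Sum>j<k. \<sigma> f $$ (i, j) * w $ j) = c f * (\<sigma> f *\<^sub>v w) $ i"
          using i wc by (simp add: scalar_prod_def lessThan_atLeast0)
      qed
      finally show "(\<sigma> g *\<^sub>v w) $ i = vec k (\<lambda>i. \<Sum>f\<in>F. c f * (\<sigma> f *\<^sub>v w) $ i) $ i"
        using i by simp
    qed (use unitary_repD(1)[OF \<sigma> g] in simp)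
    moreover have "\<sigma> f *\<^sub>v w \<in> W" if "f \<in> F" for f
      using that F(2) inv w by auto
    ultimately show ?thesis using subspace_lincomb[OF W F(1), of "\<lambda>f. \<sigma> f *\<^sub>v w"] by simp
  qed
  then show "W = {0\<^sub>v k} \<or> W = carrier_vec k"
    using irr W by (auto simp: irreducible_rep_def)
qed

text \<open>The relation is linear in the pair \<open>(\<sigma> g, \<tau> g)\<close>, so it spreads
  from \<open>F\<close> to \<open>g\<close> when the same coefficients \<open>c\<close> express both
  components.\<close>

lemma intertwiner_extends_from_spanning:
  fixes U :: "complex mat"
  assumes U: "U \<in> carrier_mat k k"
    and carr: "\<And>g. g \<in> C \<Longrightarrow> \<sigma> g \<in> carrier_mat k k" "\<And>g. g \<in> C \<Longrightarrow> \<tau> g \<in> carrier_mat k k"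
    and F: "F \<subseteq> C" "\<And>f. f \<in> F \<Longrightarrow> U * \<sigma> f = \<tau> f * U" and g: "g \<in> C"
    and \<sigma>: "\<And>i j. i < k \<Longrightarrow> j < k \<Longrightarrow> \<sigma> g $$ (i, j) = (\<Sum>f\<in>F. c f * \<sigma> f $$ (i, j))"
    and \<tau>: "\<And>i j. i < k \<Longrightarrow> j < k \<Longrightarrow> \<tau> g $$ (i, j) = (\<Sum>f\<in>F. c f * \<tau> f $$ (i, j))"
  shows "U * \<sigma> g = \<tau> g * U"
proof (rule eq_matI)
  fix i j assume "i < dim_row (\<tau> g * U)" "j < dim_col (\<tau> g * U)"
  then have ij: "i < k" "j < k" using U carr(2)[OF g] by auto
  have "(U * \<sigma> g) $$ (i, j) = (\<Sum>p<k. \<Sum>f\<in>F. U $$ (i, p) * (c f * \<sigma> f $$ (p, j)))"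
    using ij U carr(1)[OF g]
    by (simp add: scalar_prod_def lessThan_atLeast0 \<sigma> sum_distrib_left)
  also have "\<dots> = (\<Sum>f\<in>F. c f * (\<Sum>p<k. U $$ (i, p) * \<sigma> f $$ (p, j)))"
    unfolding sum_distrib_left
    by (subst sum.swap) (intro sum.cong refl, simp add: mult.left_commute)
  also have "\<dots> = (\<Sum>f\<in>F. c f * (\<Sum>p<k. \<tau> f $$ (i, p) * U $$ (p, j)))"
  proof (rule sum.cong[OF refl])
    fix f assume f: "f \<in> F"
    then have "f \<in> C" using F(1) by blast
    note fc = carr[OF this]
    have "(U * \<sigma> f) $$ (i, j) = (\<tau> f * U) $$ (i, j)" using F(2)[OF f] by simp
    then show "c f * (\<Sum>p<k. U $$ (i, p) * \<sigma> f $$ (p, j)) =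
        c f * (\<Sum>p<k. \<tau> f $$ (i, p) * U $$ (p, j))"
      using ij U fc by (simp add: scalar_prod_def lessThan_atLeast0)
  qed
  also have "\<dots> = (\<Sum>p<k. \<Sum>f\<in>F. c f * \<tau> f $$ (i, p) * U $$ (p, j))"
    by (subst sum.swap) (simp add: sum_distrib_left mult.assoc)
  also have "\<dots> = (\<tau> g * U) $$ (i, j)"
    using ij U carr(2)[OF g]
    by (simp add: scalar_prod_def lessThan_atLeast0 \<tau> sum_distrib_right)
  finally show "(U * \<sigma> g) $$ (i, j) = (\<tau> g * U) $$ (i, j)" .
qed (use U carr[OF g] in auto)

lemma direct_sum_comp: "direct_sum T d (\<lambda>t. \<sigma> t \<circ> \<phi>) g = direct_sum T d \<sigma> (\<phi> g)"
  by (simp add: direct_sum_def)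

text \<open>Restriction could make components reducible or equivalent; the spanning set
  \<open>F\<close> inside the image prevents both. For inequivalence, \<open>c\<close> must be
  common to all \<open>t\<close>.\<close>

lemma irreducible_decomposition_comp:
  assumes dec: "irreducible_decomposition G m \<pi> T k \<sigma> d" and hom: "\<phi> \<in> hom K G"
    and F: "finite F" "F \<subseteq> \<phi> ` carrier K" "F \<subseteq> carrier G"
    and span: "\<And>g. g \<in> carrier G \<Longrightarrow> \<exists>c. \<forall>t\<in>T. \<forall>i<k t. \<forall>j<k t.
      \<sigma> t g $$ (i, j) = (\<Sum>f\<in>F. c f * \<sigma> t f $$ (i, j))"
  shows "irreducible_decomposition K m (\<pi> \<circ> \<phi>) T k (\<lambda>t. \<sigma> t \<circ> \<phi>) d"
proof -
  have \<phi>: "\<phi> g \<in> carrier G" if "g \<in> carrier K" for g using hom that by (auto simp: hom_def)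
  have fin: "finite T"
    and rep: "\<And>t. t \<in> T \<Longrightarrow> unitary_rep G (k t) (\<sigma> t)"
      "\<And>t. t \<in> T \<Longrightarrow> irreducible_rep G (k t) (\<sigma> t)" "\<And>t. t \<in> T \<Longrightarrow> 1 \<le> d t"
    and neq: "\<And>s t. s \<in> T \<Longrightarrow> t \<in> T \<Longrightarrow> s \<noteq> t \<Longrightarrow>
      \<not> unitarily_equivalent G (k s) (\<sigma> s) (k t) (\<sigma> t)"
    and eqv: "unitarily_equivalent G m \<pi> (\<Sum>t\<in>T. d t * k t) (direct_sum T d \<sigma>)"
    using dec by (auto simp: irreducible_decomposition_def)
  have irr: "irreducible_rep K (k t) (\<sigma> t \<circ> \<phi>)" if "t \<in> T" for t
    using span that by (intro irreducible_rep_comp[OF rep(2)[OF that] rep(1)[OF that] F]) blast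
  have "\<not> unitarily_equivalent K (k s) (\<sigma> s \<circ> \<phi>) (k t) (\<sigma> t \<circ> \<phi>)"
    if st: "s \<in> T" "t \<in> T" "s \<noteq> t" for s t
  proof
    assume "unitarily_equivalent K (k s) (\<sigma> s \<circ> \<phi>) (k t) (\<sigma> t \<circ> \<phi>)"
    then obtain U where k: "k s = k t" and U: "unitary_mat (k t) U"
      and eq: "\<And>g. g \<in> carrier K \<Longrightarrow> U * \<sigma> s (\<phi> g) = \<sigma> t (\<phi> g) * U"
      by (auto simp: unitarily_equivalent_def)
    have "U * \<sigma> s g = \<sigma> t g * U" if g: "g \<in> carrier G" for g
    proof -
      obtain c where c: "\<forall>t\<in>T. \<forall>i<k t. \<forall>j<k t.
          \<sigma> t g $$ (i, j) = (\<Sum>f\<in>F. c f * \<sigma> t f $$ (i, j))"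
        using span[OF g] by blast
      show ?thesis
      proof (rule intertwiner_extends_from_spanning[of U "k t" "carrier G" "\<sigma> s" "\<sigma> t" F g c])
        show "U \<in> carrier_mat (k t) (k t)" using U by (simp add: unitary_mat_def)
        show "U * \<sigma> s f = \<sigma> t f * U" if "f \<in> F" for f
          using that F(2) eq by blast
      qed (use F(3) g c k st unitary_repD(1)[OF rep(1)[OF st(1)]] unitary_repD(1)[OF rep(1)[OF st(2)]]
          in simp_all)
    qed
    then have "unitarily_equivalent G (k s) (\<sigma> s) (k t) (\<sigma> t)"
      using k U by (auto simp: unitarily_equivalent_def)
    then show False using neq[OF st] by simp
  qed
  moreover have "unitarily_equivalent K m (\<pi> \<circ> \<phi>) (\<Sum>t\<in>T. d t * k t)
      (direct_sum T d (\<lambda>t. \<sigma> t \<circ> \<phi>))"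
    using eqv \<phi> by (auto simp: unitarily_equivalent_def direct_sum_comp)
  ultimately show ?thesis
    using fin rep irr unitary_rep_comp[OF _ hom] by (simp add: irreducible_decomposition_def)
qed

text \<open>This concerns every \<open>c\<close> that is valid over \<open>nat\<close>, not only the
  explicit constant, so an arbitrary instance has to be moved to a group on \<open>nat\<close> with
  the same \<open>T\<close>, \<open>k\<close> and \<open>card S\<close>.\<close>

lemma bound_holds_transfer:
  assumes nat: "bound_holds TYPE(nat) \<epsilon> c"
  shows "bound_holds TYPE('g) \<epsilon> c"
  unfolding bound_holds_def
proof (intro allI impI)
  fix G :: "'g monoid" and m \<pi> S T k \<sigma> d N
  assume G: "group G" and \<pi>: "unitary_rep G m \<pi>"
    and S: "S \<subseteq> carrier G" "finite S" "S \<noteq> {}"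
    and gap: "ereal \<epsilon> \<le> epsilon_rep G (m * m) (tensor_rep \<pi> (conj_rep \<pi>)) S"
    and dec: "irreducible_decomposition G m \<pi> T k \<sigma> d" and N: "1 \<le> (N::nat)"
  interpret group G by (rule G)
  \<comment> \<open>All matrix entries of all components form one family, which yields coefficients
    independent of \<open>t\<close>.\<close>
  define x where "x g = (\<lambda>(t, i, j). \<sigma> t g $$ (i, j))" for g
  have "finite (SIGMA t:T. {..<k t} \<times> {..<k t})"
    using dec by (simp add: irreducible_decomposition_def)
  from ex_finite_spanning_subfamily[OF this, of "carrier G" x]
  obtain F where F: "F \<subseteq> carrier G" "finite F"
    and x: "\<forall>g\<in>carrier G.
      \<exists>c. \<forall>z\<in>SIGMA t:T. {..<k t} \<times> {..<k t}. x g z = (\<Sum>f\<in>F. c f * x f z)"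
    by (elim exE conjE) (rule that)
  have span: "\<exists>c. \<forall>t\<in>T. \<forall>i<k t. \<forall>j<k t. \<sigma> t g $$ (i, j) = (\<Sum>f\<in>F. c f * \<sigma> t f $$ (i, j))"
    if "g \<in> carrier G" for g
    using bspec[OF x that] by (elim ex_forward) (auto simp: x_def)
  have FS: "F \<union> S \<subseteq> carrier G" using F S by blast
  define H where "H = generate G (F \<union> S)"
  have H: "F \<subseteq> H" "S \<subseteq> H" by (auto simp: H_def generate.incl)
  have "countable H"
    unfolding H_def using F(2) S(2) by (intro countable_generate[OF G FS]) (simp add: countable_finite)
  then obtain K :: "nat monoid" and \<phi> where K: "group K" and hom: "\<phi> \<in> hom K G"
    and inj: "inj_on \<phi> (carrier K)" and im: "\<phi> ` carrier K = H"
    by (rule countable_subgroup_ex_nat_group[OF generate_is_subgroup[OF FS] G, folded H_def]) (rule that)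
  \<comment> \<open>Since \<phi> is injective on the carrier with image \<open>H\<close>, which
    contains \<open>S\<close>, this preimage has as many elements as \<open>S\<close>.\<close>
  define S' where "S' = {a \<in> carrier K. \<phi> a \<in> S}"
  have S': "S' \<subseteq> carrier K" "\<phi> ` S' = S" "inj_on \<phi> S'"
    using H(2) im inj by (auto simp: S'_def inj_on_def)
  have fin: "finite S'" using S(2) S'(2,3) by (metis finite_image_iff)
  have card: "card S' = card S" using S'(2,3) by (metis card_image)
  have tensor: "tensor_rep (\<pi> \<circ> \<phi>) (conj_rep (\<pi> \<circ> \<phi>)) = tensor_rep \<pi> (conj_rep \<pi>) \<circ> \<phi>"
    by (auto simp: tensor_rep_def conj_rep_def)
  have carr: "tensor_rep \<pi> (conj_rep \<pi>) s \<in> carrier_mat (m * m) (m * m)" if "s \<in> \<phi> ` S'" for s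
    using unitary_repD(1)[OF \<pi>, of s] that S(1) unfolding S'(2)
    by (auto simp: tensor_rep_def conj_rep_def kronecker_def)
  have "ereal \<epsilon> \<le> epsilon_rep K (m * m) (tensor_rep (\<pi> \<circ> \<phi>) (conj_rep (\<pi> \<circ> \<phi>))) S'"
    unfolding tensor
    by (rule order_trans[OF gap epsilon_rep_le_comp[OF hom fin S'(1,3) carr, unfolded S'(2)]])
  moreover have "F \<subseteq> \<phi> ` carrier K" using H(1) im by simp
  then have "irreducible_decomposition K m (\<pi> \<circ> \<phi>) T k (\<lambda>t. \<sigma> t \<circ> \<phi>) d"
    by (rule irreducible_decomposition_comp[OF dec hom F(2) _ F(1) span])
  moreover have "S' \<noteq> {}" using S(3) S'(2) by blast
  ultimately have "real (card {t \<in> T. k t \<le> N}) \<le> exp (c * real (card S') * (real N)\<^sup>2)"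
    using nat[unfolded bound_holds_def, rule_format, OF K unitary_rep_comp[OF \<pi> hom] S'(1) fin _ _ _ N]
    by blast
  then show "real (card {t \<in> T. k t \<le> N}) \<le> exp (c * real (card S) * (real N)\<^sup>2)"
    by (simp only: card)
qed

theorem proposition2p8:
  fixes \<epsilon> :: real
  assumes "0 < \<epsilon>" and "\<epsilon> < 1"
  shows "(\<exists>c>0. bound_holds TYPE(nat) \<epsilon> c) \<and>
         (\<forall>c>0. bound_holds TYPE(nat) \<epsilon> c \<longrightarrow> bound_holds TYPE('g) \<epsilon> c)"
proof (intro conjI allI impI)
  have "0 < 8 / \<epsilon> + 5" using assms(1) by (simp add: add_pos_pos)
  with bound_holds_explicit[OF assms(1)] show "\<exists>c>0. bound_holds TYPE(nat) \<epsilon> c" by blast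
qed (rule bound_holds_transfer)

end
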